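(* Let $\phi:\mathbb{R}^m\to\overline{\mathbb{R}}$ satisfy (A1)--(A5) of the context, let $f:\mathbb{R}^m\to\overline{\mathbb{R}}$ and $g:\mathbb{R}^n\to\overline{\mathbb{R}}$ be proper and lower semicontinuous, and let $A\in\mathbb{R}^{m\times n}$. Let $(\bar u,\bar z)$ be a stationary point for the splitting model $$\min_{u\in\mathbb{R}^n,\,z\in\mathbb{R}^m}\ f(z)+\frac1\lambda\phi(Au-z)+g(u)$$ satisfying $A\bar u-\bar z\in\operatorname{dom}\phi$, $\bar u\in\operatorname{dom}g$, $\bar z\in\operatorname{dom}f$ and the conditions $$0\in\partial g(\bar u)+\tfrac1\lambda A^\top\nabla\phi(A\bar u-\bar z),\qquad 0\in\partial f(\bar z)-\tfrac1\lambda\nabla\phi(A\bar u-\bar z).$$ Let $f$ be $\phi$-prox-bounded with threshold $\lambda_f$ and prox-regular at $\bar z$ for $\bar y:=\frac1\lambda\nabla\phi(A\bar u-\bar z)$. Then, for $\lambda\in(0,\lambda_f)$ sufficiently small, the stationarity condition $$0\in A^\top\nabla e_\lambda^\phi f(A\bar u)+\partial g(\bar u)$$ is fulfilled, i.e., $\bar u$ is a stationary point for the inf-convolution model $\min_{u\in\mathbb{R}^n}e_\lambda^\phi f(Au)+g(u)$.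
   Context: $\overline{\mathbb{R}}=\mathbb{R}\cup\{+\infty,-\infty\}$; $\operatorname{dom}f=\{z:f(z)<\infty\}$; lsc means lower semicontinuous. $f$ is proper if $f>-\infty$ everywhere and $f(z)<\infty$ for some $z$. A stationary point of the inf-convolution model is a point $\bar u$ with $0\in\partial(e_\lambda^\phi f\circ A+g)(\bar u)$; a stationary point of the splitting model is a point at which $0$ belongs to the (limiting) subdifferential of its objective. Legendre functions: a proper convex lsc $\phi$ is essentially smooth if $\operatorname{int}\operatorname{dom}\phi\neq\emptyset$ and $\phi$ is differentiable on $\operatorname{int}\operatorname{dom}\phi$ such that $\|\nabla\phi(w^\nu)\|\to\infty$ whenever $w^\nu\to w\in\operatorname{bdry}\operatorname{dom}\phi$; essentially strictly convex if it is strictly convex on every convex subset of $\{w:\partial\phi(w)\neq\emptyset\}$ ($\partial\phi$ the convex subdifferential); Legendre if both. Assumptions on $\phi$: (A1) $\phi$ is proper lsc convex and Legendre; (A2) $\operatorname{dom}\phi$ is open; (A3) $\phi$ is twice continuously differentiable on $\operatorname{int}\operatorname{dom}\phi$ with $\nabla^2\phi(w)\succ0$ for all $w\in\operatorname{int}\operatorname{dom}\phi$; (A4) $\phi$ is super-coercive: $|\phi(w)|/\|w\|\to\infty$ whenever $\|w\|\to\infty$; (A5) $\phi(0)=0$ and $\nabla\phi(0)=0$. For $\lambda>0$, the $\phi$-envelope of $f$ is $e_\lambda^\phi f(v)=\inf_{z\in\mathbb{R}^m}f(z)+\tfrac1\lambda\phi(v-z)$. $f$ is $\phi$-prox-bounded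 if there exists $\lambda>0$ such that for any $\bar v\in\mathbb{R}^m$ there exist $\epsilon>0$ and $\beta>-\infty$ with $e_\lambda^\phi f(v)\ge\beta$ for any $v$ with $\|v-\bar v\|\le\epsilon$. The supremum of the set of all such $\lambda$ is the threshold $\lambda_f$. Subdifferentials: for $\bar z\in\operatorname{dom}f$, $y\in\widehat\partial f(\bar z)$ (regular subdifferential) if $\liminf_{z\to\bar z,\,z\neq\bar z}\frac{f(z)-f(\bar z)-\langle y,z-\bar z\rangle}{\|z-\bar z\|}\ge0$; $y\in\partial f(\bar z)$ (limiting subdifferential) if there exist $z^\nu\to\bar z$ with $f(z^\nu)\to f(\bar z)$ and $y^\nu\in\widehat\partial f(z^\nu)$ with $y^\nu\to y$. The same definitions apply to other functions. Prox-regularity: $f$, lsc and finite at $\bar z$, is prox-regular at $\bar z$ for $\bar y\in\partial f(\bar z)$ if there exist $\epsilon>0$ and $r\ge0$ such that for all $\|z'-\bar z\|<\epsilon$, $f(z')\ge f(z)+\langle y,z'-z\rangle-\frac r2\|z'-z\|^2$ whenever $\|z-\bar z\|<\epsilon$, $f(z)-f(\bar z)<\epsilon$, $y\in\partial f(z)$, $\|y-\bar y\|<\epsilon$. *)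

theory Defs
  imports "HOL-Analysis.Analysis"
begin

section \<open>Extended-real-valued functions\<close>

definition edom :: "('a \<Rightarrow> ereal) \<Rightarrow> 'a set" where
  "edom f = {z. f z < \<infinity>}"

definition proper_fun :: "('a \<Rightarrow> ereal) \<Rightarrow> bool" where
  "proper_fun f \<longleftrightarrow> (\<forall>z. f z > - \<infinity>) \<and> (\<exists>z. f z < \<infinity>)"

definition lsc_at :: "('a::topological_space \<Rightarrow> ereal) \<Rightarrow> 'a \<Rightarrow> bool" where
  "lsc_at f z \<longleftrightarrow> f z \<le> Liminf (at z) f"

definition lsc_fun :: "('a::topological_space \<Rightarrow> ereal) \<Rightarrow> bool" where
  "lsc_fun f \<longleftrightarrow> (\<forall>z. lsc_at f z)"

text \<open>Convexity is convexity of the epigraph, which avoids sums \<open>\<infinity> - \<infinity>\<close>.\<close>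

definition convex_fun :: "('a::real_vector \<Rightarrow> ereal) \<Rightarrow> bool" where
  "convex_fun f \<longleftrightarrow> convex {(z, r::real). f z \<le> ereal r}"

section \<open>Gradients\<close>

text \<open>An extended-real-valued function is differentiable at \<open>x\<close> if it is finite in a
  neighbourhood of \<open>x\<close> and its real-valued version is Frechet differentiable at \<open>x\<close>.\<close>

definition has_egradient :: "('a::real_inner \<Rightarrow> ereal) \<Rightarrow> 'a \<Rightarrow> 'a \<Rightarrow> bool" where
  "has_egradient f D x \<longleftrightarrow>
     (\<forall>\<^sub>F y in nhds x. \<bar>f y\<bar> \<noteq> \<infinity>) \<and> GDERIV (\<lambda>y. real_of_ereal (f y)) x :> D"

definition edifferentiable :: "('a::real_inner \<Rightarrow> ereal) \<Rightarrow> 'a \<Rightarrow> bool" where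
  "edifferentiable f x \<longleftrightarrow> (\<exists>D. has_egradient f D x)"

definition egrad :: "('a::real_inner \<Rightarrow> ereal) \<Rightarrow> 'a \<Rightarrow> 'a" where
  "egrad f x = (THE D. has_egradient f D x)"

lemma has_egradient_unique:
  assumes "has_egradient f D x" "has_egradient f E x"
  shows "D = E"
proof -
  have "(\<lambda>h. inner h D) = (\<lambda>h. inner h E)"
    using assms has_derivative_unique unfolding has_egradient_def gderiv_def by blast
  then show ?thesis
    by (metis vector_eq_ldot)
qed

lemma egrad_eq: "has_egradient f D x \<Longrightarrow> egrad f x = D"
  unfolding egrad_def using has_egradient_unique by blast

definition ehessian :: "(real^'m \<Rightarrow> ereal) \<Rightarrow> real^'m \<Rightarrow> real^'m^'m" where
  "ehessian f x = jacobian (egrad f) (at x)"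

definition twice_cont_diff_on :: "(real^'m) set \<Rightarrow> (real^'m \<Rightarrow> ereal) \<Rightarrow> bool" where
  "twice_cont_diff_on S f \<longleftrightarrow>
     (\<forall>x\<in>S. edifferentiable f x \<and> egrad f differentiable (at x)) \<and>
     continuous_on S (ehessian f)"

definition pos_def_matrix :: "real^'m^'m \<Rightarrow> bool" where
  "pos_def_matrix H \<longleftrightarrow> transpose H = H \<and> (\<forall>h. h \<noteq> 0 \<longrightarrow> h \<bullet> (H *v h) > 0)"

section \<open>Legendre functions\<close>

definition convex_subdiff :: "('a::real_inner \<Rightarrow> ereal) \<Rightarrow> 'a \<Rightarrow> 'a set" where
  "convex_subdiff f w = {y. \<forall>z. f z \<ge> f w + ereal (y \<bullet> (z - w))}"

definition ess_smooth :: "('a::real_inner \<Rightarrow> ereal) \<Rightarrow> bool" where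
  "ess_smooth f \<longleftrightarrow>
     interior (edom f) \<noteq> {} \<and>
     (\<forall>w\<in>interior (edom f). edifferentiable f w) \<and>
     (\<forall>w\<in>frontier (edom f). \<forall>ws. (\<forall>k. ws k \<in> interior (edom f)) \<and> ws \<longlonglongrightarrow> w \<longrightarrow>
        filterlim (\<lambda>k. norm (egrad f (ws k))) at_top sequentially)"

definition strictly_convex_fun_on :: "'a::real_vector set \<Rightarrow> ('a \<Rightarrow> ereal) \<Rightarrow> bool" where
  "strictly_convex_fun_on C f \<longleftrightarrow>
     (\<forall>x\<in>C. \<forall>y\<in>C. \<forall>t. x \<noteq> y \<and> 0 < t \<and> t < 1 \<longrightarrow>
        f ((1 - t) *\<^sub>R x + t *\<^sub>R y) < ereal (1 - t) * f x + ereal t * f y)"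

definition ess_strictly_convex :: "('a::real_inner \<Rightarrow> ereal) \<Rightarrow> bool" where
  "ess_strictly_convex f \<longleftrightarrow>
     (\<forall>C. convex C \<and> C \<subseteq> {w. convex_subdiff f w \<noteq> {}} \<longrightarrow> strictly_convex_fun_on C f)"

definition legendre :: "('a::real_inner \<Rightarrow> ereal) \<Rightarrow> bool" where
  "legendre f \<longleftrightarrow>
     proper_fun f \<and> lsc_fun f \<and> convex_fun f \<and> ess_smooth f \<and> ess_strictly_convex f"

definition super_coercive :: "('a::real_normed_vector \<Rightarrow> ereal) \<Rightarrow> bool" where
  "super_coercive f \<longleftrightarrow> ((\<lambda>w. \<bar>f w\<bar> / ereal (norm w)) \<longlongrightarrow> \<infinity>) at_infinity"

section \<open>Envelopes and prox-boundedness\<close>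

definition phi_envelope ::
    "('a::real_vector \<Rightarrow> ereal) \<Rightarrow> real \<Rightarrow> ('a \<Rightarrow> ereal) \<Rightarrow> 'a \<Rightarrow> ereal" where
  "phi_envelope \<phi> lam f v = (INF z. f z + ereal (1 / lam) * \<phi> (v - z))"

definition prox_bounded_param ::
    "('a::real_normed_vector \<Rightarrow> ereal) \<Rightarrow> ('a \<Rightarrow> ereal) \<Rightarrow> real \<Rightarrow> bool" where
  "prox_bounded_param \<phi> f lam \<longleftrightarrow> lam > 0 \<and>
     (\<forall>vb. \<exists>\<epsilon>>0. \<exists>\<beta>. \<beta> > - \<infinity> \<and>
        (\<forall>v. norm (v - vb) \<le> \<epsilon> \<longrightarrow> phi_envelope \<phi> lam f v \<ge> \<beta>))"

definition prox_bounded ::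
    "('a::real_normed_vector \<Rightarrow> ereal) \<Rightarrow> ('a \<Rightarrow> ereal) \<Rightarrow> bool" where
  "prox_bounded \<phi> f \<longleftrightarrow> (\<exists>lam. prox_bounded_param \<phi> f lam)"

text \<open>The threshold may be \<open>\<infinity>\<close>.\<close>

definition prox_threshold ::
    "('a::real_normed_vector \<Rightarrow> ereal) \<Rightarrow> ('a \<Rightarrow> ereal) \<Rightarrow> ereal" where
  "prox_threshold \<phi> f = Sup (ereal ` {lam. prox_bounded_param \<phi> f lam})"

section \<open>Subdifferentials, stationarity and prox-regularity\<close>

text \<open>Subdifferentials are empty at points where the function is not finite. For functions
  that never take the value \<open>-\<infinity>\<close> this means that they are empty outside the domain.\<close>

definition regular_subdiff :: "('a::real_inner \<Rightarrow> ereal) \<Rightarrow> 'a \<Rightarrow> 'a set" where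
  "regular_subdiff f zb =
     {y. \<bar>f zb\<bar> \<noteq> \<infinity> \<and>
         Liminf (at zb) (\<lambda>z. (f z - f zb - ereal (y \<bullet> (z - zb))) / ereal (norm (z - zb))) \<ge> 0}"

definition limiting_subdiff :: "('a::real_inner \<Rightarrow> ereal) \<Rightarrow> 'a \<Rightarrow> 'a set" where
  "limiting_subdiff f zb =
     {y. \<bar>f zb\<bar> \<noteq> \<infinity> \<and>
         (\<exists>zs ys. zs \<longlonglongrightarrow> zb \<and> (\<lambda>k. f (zs k)) \<longlonglongrightarrow> f zb \<and>
                  (\<forall>k. ys k \<in> regular_subdiff f (zs k)) \<and> ys \<longlonglongrightarrow> y)}"

definition stationary :: "('a::real_inner \<Rightarrow> ereal) \<Rightarrow> 'a \<Rightarrow> bool" where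
  "stationary F x \<longleftrightarrow> 0 \<in> limiting_subdiff F x"

definition prox_regular :: "('a::real_inner \<Rightarrow> ereal) \<Rightarrow> 'a \<Rightarrow> 'a \<Rightarrow> bool" where
  "prox_regular f zb yb \<longleftrightarrow>
     lsc_at f zb \<and> \<bar>f zb\<bar> \<noteq> \<infinity> \<and> yb \<in> limiting_subdiff f zb \<and>
     (\<exists>\<epsilon>>0. \<exists>r\<ge>0. \<forall>z' z y.
        norm (z' - zb) < \<epsilon> \<and> norm (z - zb) < \<epsilon> \<and> f z - f zb < ereal \<epsilon> \<and>
        y \<in> limiting_subdiff f z \<and> norm (y - yb) < \<epsilon> \<longrightarrow>
        f z' \<ge> f z + ereal (y \<bullet> (z' - z) - r / 2 * (norm (z' - z))\<^sup>2))"

section \<open>The two models\<close>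

definition splitting_objective ::
    "(real^'m \<Rightarrow> ereal) \<Rightarrow> real \<Rightarrow> (real^'m \<Rightarrow> ereal) \<Rightarrow> (real^'n \<Rightarrow> ereal) \<Rightarrow> real^'n^'m
      \<Rightarrow> (real^'n) \<times> (real^'m) \<Rightarrow> ereal" where
  "splitting_objective \<phi> lam f g A =
     (\<lambda>(u, z). f z + ereal (1 / lam) * \<phi> (A *v u - z) + g u)"

definition inf_conv_objective ::
    "(real^'m \<Rightarrow> ereal) \<Rightarrow> real \<Rightarrow> (real^'m \<Rightarrow> ereal) \<Rightarrow> (real^'n \<Rightarrow> ereal) \<Rightarrow> real^'n^'m
      \<Rightarrow> real^'n \<Rightarrow> ereal" where
  "inf_conv_objective \<phi> lam f g A = (\<lambda>u. phi_envelope \<phi> lam f (A *v u) + g u)"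

end

theory Submission
  imports Defs
begin

text \<open>
  Write \<open>w = A u - z\<close> for the difference at the stationary point, so that
  \<open>\<nabla>\<phi> w = \<lambda> y\<close> with \<open>y\<close> fixed. The heart of the matter is that for small \<open>\<lambda>\<close> the envelope is
  continuously differentiable near \<open>A u = z + w\<close> with gradient \<open>y\<close> at that point
  (\<open>phi_envelope_continuously_differentiable\<close>). The assumed inclusion for \<open>\<partial>g\<close> then says
  \<open>0 \<in> A\<^sup>T \<nabla>e (A u) + \<partial>g u\<close>, and the sum rule for a continuously differentiable summand
  (\<open>limiting_subdiff_add_smooth\<close>) turns this into stationarity for the inf-convolution model.

  The envelope is smooth because positive curvature of the kernel beats the defect of convexity
  of \<open>f\<close>. Near the origin the positive definite Hessian makes \<open>\<phi>\<close> strongly convex with some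
  modulus \<open>\<mu>\<close>, so \<open>\<phi>/\<lambda>\<close> has modulus \<open>\<mu>/\<lambda>\<close>, which exceeds the prox-regularity constant \<open>r\<close> of \<open>f\<close>
  once \<open>\<lambda>\<close> is small. If \<open>p\<close> minimises \<open>f p + \<phi>(v - p)/\<lambda>\<close>, then
  \<open>\<nabla>\<phi>(v - p)/\<lambda>\<close> is a subgradient of \<open>f\<close> at \<open>p\<close>; adding the prox-regularity inequality for it to the
  strong convexity inequality gives quadratic growth around \<open>p\<close>. Hence the minimiser \<open>P v\<close> is
  unique and Hoelder continuous in \<open>v\<close>, and the two-sided estimate
  \<open>\<nabla>\<phi>(v - P v')/\<lambda> \<bullet> (v' - v) \<le> e v' - e v \<le> \<nabla>\<phi>(v' - P v)/\<lambda> \<bullet> (v' - v)\<close>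
  identifies \<open>\<nabla>\<phi>(v - P v)/\<lambda>\<close> as the gradient.

  Prox-regularity only speaks about points near \<open>z\<close>, so minimisers have to be confined there.
  Two estimates do this. First, \<open>\<phi>\<close> grows at least linearly away from the
  origin, while \<open>\<phi> w \<le> \<nabla>\<phi> w \<bullet> w = \<lambda> (y \<bullet> w)\<close>; together these force \<open>w\<close> to be small. Second, the
  lower bound from prox-boundedness at one fixed parameter \<open>\<lambda>\<^sub>1\<close> leaves, at distance at least
  \<open>\<delta>\<close> from \<open>v\<close>, an extra penalty \<open>(1/\<lambda> - 1/\<lambda>\<^sub>1) \<phi>(v - p)\<close> that tends to infinity as
  \<open>\<lambda>\<close> tends to 0, whereas the value at \<open>z\<close> stays bounded by \<open>f z + y \<bullet> w\<close>.
\<close>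

section \<open>Calculus of regular and limiting subgradients\<close>

text \<open>The first-order minorant form \<open>f z \<ge> f x + y \<bullet> (z - x) - \<eta> \<parallel>z - x\<parallel>\<close> involves neither a quotient
  nor a difference of extended reals, and it holds trivially at \<open>z = x\<close>, so that \<open>nhds x\<close> can
  replace \<open>at x\<close>. All later reasoning about regular subgradients goes through it.\<close>

lemma regular_subdiff_iff:
  fixes f :: "'a::real_inner \<Rightarrow> ereal"
  shows "y \<in> regular_subdiff f x \<longleftrightarrow> \<bar>f x\<bar> \<noteq> \<infinity> \<and>
    (\<forall>\<eta>>0. \<forall>\<^sub>F z in nhds x. f x + ereal (y \<bullet> (z - x) - \<eta> * norm (z - x)) \<le> f z)"
proof (cases "\<bar>f x\<bar> = \<infinity>")
  case True
  then show ?thesis by (simp add: regular_subdiff_def)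
next
  case False
  then obtain a where a: "f x = ereal a" by auto
  let ?X = "\<lambda>z. (f z - f x - ereal (y \<bullet> (z - x))) / ereal (norm (z - x))"
  have lt: "ereal (- \<eta>) < ?X z \<longleftrightarrow> ereal (a + (y \<bullet> (z - x) - \<eta> * norm (z - x))) < f z"
    if "z \<noteq> x" for z \<eta>
  proof -
    have "norm (z - x) > 0" using that by simp
    then show ?thesis
      by (cases "f z") (auto simp: a field_simps)
  qed
  have "0 \<le> Liminf (at x) ?X \<longleftrightarrow> (\<forall>c<0. \<forall>\<^sub>F z in at x. c < ?X z)"
    by (rule le_Liminf_iff)
  also have "\<dots> \<longleftrightarrow> (\<forall>\<eta>>0. \<forall>\<^sub>F z in at x. ereal (- \<eta>) < ?X z)"
  proof (intro iffI allI impI)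
    fix c :: ereal assume *: "\<forall>\<eta>>0. \<forall>\<^sub>F z in at x. ereal (- \<eta>) < ?X z" and "c < 0"
    obtain \<eta> :: real where "\<eta> > 0" "c \<le> ereal (- \<eta>)"
    proof (cases c)
      case (real r)
      then show ?thesis using that[of "- r"] \<open>c < 0\<close> by auto
    next
      case MInf
      then show ?thesis using that[of 1] by simp
    next
      case PInf
      then show ?thesis using \<open>c < 0\<close> by simp
    qed
    have "\<forall>\<^sub>F z in at x. ereal (- \<eta>) < ?X z" using * \<open>\<eta> > 0\<close> by blast
    then show "\<forall>\<^sub>F z in at x. c < ?X z"
      by (rule eventually_mono) (rule order_le_less_trans[OF \<open>c \<le> ereal (- \<eta>)\<close>])
  next
    fix \<eta> :: real assume *: "\<forall>c<0. \<forall>\<^sub>F z in at x. c < ?X z" and "\<eta> > 0"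
    then show "\<forall>\<^sub>F z in at x. ereal (- \<eta>) < ?X z" by simp
  qed
  also have "\<dots> \<longleftrightarrow> (\<forall>\<eta>>0. \<forall>\<^sub>F z in at x. ereal (a + (y \<bullet> (z - x) - \<eta> * norm (z - x))) < f z)"
    by (intro all_cong1 imp_cong refl eventually_subst) (simp add: eventually_at_filter lt)
  also have "\<dots> \<longleftrightarrow> (\<forall>\<eta>>0. \<forall>\<^sub>F z in at x. ereal (a + (y \<bullet> (z - x) - \<eta> * norm (z - x))) \<le> f z)"
  proof (intro iffI allI impI)
    fix \<eta> :: real
    assume *: "\<forall>\<eta>>0. \<forall>\<^sub>F z in at x. ereal (a + (y \<bullet> (z - x) - \<eta> * norm (z - x))) \<le> f z" and "\<eta> > 0"
    then have "\<forall>\<^sub>F z in at x. ereal (a + (y \<bullet> (z - x) - \<eta> / 2 * norm (z - x))) \<le> f z"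
      by (meson half_gt_zero)
    then have "\<forall>\<^sub>F z in at x. z \<noteq> x \<and> ereal (a + (y \<bullet> (z - x) - \<eta> / 2 * norm (z - x))) \<le> f z"
      by (simp add: eventually_at_filter)
    then show "\<forall>\<^sub>F z in at x. ereal (a + (y \<bullet> (z - x) - \<eta> * norm (z - x))) < f z"
    proof (rule eventually_mono)
      fix z assume z: "z \<noteq> x \<and> ereal (a + (y \<bullet> (z - x) - \<eta> / 2 * norm (z - x))) \<le> f z"
      then have "\<eta> * norm (z - x) > 0" using \<open>\<eta> > 0\<close> by simp
      then have "ereal (a + (y \<bullet> (z - x) - \<eta> * norm (z - x)))
          < ereal (a + (y \<bullet> (z - x) - \<eta> / 2 * norm (z - x)))" by simp
      with z show "ereal (a + (y \<bullet> (z - x) - \<eta> * norm (z - x))) < f z" by (meson less_le_trans)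
    qed
  next
    fix \<eta> :: real
    assume "\<forall>\<eta>>0. \<forall>\<^sub>F z in at x. ereal (a + (y \<bullet> (z - x) - \<eta> * norm (z - x))) < f z" and "\<eta> > 0"
    then have "\<forall>\<^sub>F z in at x. ereal (a + (y \<bullet> (z - x) - \<eta> * norm (z - x))) < f z" by blast
    then show "\<forall>\<^sub>F z in at x. ereal (a + (y \<bullet> (z - x) - \<eta> * norm (z - x))) \<le> f z"
      by (rule eventually_mono) (rule less_imp_le)
  qed
  also have "\<dots> \<longleftrightarrow> (\<forall>\<eta>>0. \<forall>\<^sub>F z in nhds x. f x + ereal (y \<bullet> (z - x) - \<eta> * norm (z - x)) \<le> f z)"
    by (simp add: eventually_nhds_conv_at a)
  finally show ?thesis
    using False by (simp add: regular_subdiff_def)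
qed

lemma regular_subdiff_subset_limiting: "regular_subdiff f x \<subseteq> limiting_subdiff f x"
proof
  fix y assume y: "y \<in> regular_subdiff f x"
  then have "(\<lambda>_. x) \<longlonglongrightarrow> x \<and> (\<lambda>_::nat. f x) \<longlonglongrightarrow> f x \<and>
      (\<forall>k::nat. y \<in> regular_subdiff f x) \<and> (\<lambda>_. y) \<longlonglongrightarrow> y" by simp
  moreover have "\<bar>f x\<bar> \<noteq> \<infinity>" using y by (simp add: regular_subdiff_def)
  ultimately show "y \<in> limiting_subdiff f x"
    unfolding limiting_subdiff_def mem_Collect_eq
    by (intro conjI exI[of _ "\<lambda>_. x"] exI[of _ "\<lambda>_. y"]) simp_all
qed

lemma has_egradient_regular_subdiff:
  assumes "has_egradient h D x"
  shows "D \<in> regular_subdiff h x"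
proof -
  let ?h = "\<lambda>y. real_of_ereal (h y)"
  have fin: "\<forall>\<^sub>F y in nhds x. \<bar>h y\<bar> \<noteq> \<infinity>" and "(?h has_derivative (\<lambda>d. d \<bullet> D)) (at x)"
    using assms by (auto simp: has_egradient_def gderiv_def)
  then have *: "\<forall>\<^sub>F z in nhds x. norm (?h z - ?h x - (z - x) \<bullet> D) \<le> \<eta> * norm (z - x)"
    if "\<eta> > 0" for \<eta>
    using that unfolding has_derivative_at_alt eventually_nhds_metric dist_norm by blast
  have hx: "\<bar>h x\<bar> \<noteq> \<infinity>" using fin by (rule eventually_nhds_x_imp_x)
  show ?thesis
    unfolding regular_subdiff_iff
  proof (intro conjI allI impI)
    fix \<eta> :: real assume "\<eta> > 0"
    show "\<forall>\<^sub>F z in nhds x. h x + ereal (D \<bullet> (z - x) - \<eta> * norm (z - x)) \<le> h z"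
      using *[OF \<open>\<eta> > 0\<close>] fin
    proof eventually_elim
      case (elim z)
      then obtain a b where "h x = ereal a" "h z = ereal b" using hx by auto
      with elim show ?case by (auto simp: inner_commute)
    qed
  qed (rule hx)
qed

lemma regular_subdiff_add:
  assumes "y1 \<in> regular_subdiff h x" "y2 \<in> regular_subdiff g x"
  shows "y1 + y2 \<in> regular_subdiff (\<lambda>u. h u + g u) x"
  unfolding regular_subdiff_iff
proof (intro conjI allI impI)
  have "\<bar>h x\<bar> \<noteq> \<infinity>" "\<bar>g x\<bar> \<noteq> \<infinity>" using assms by (simp_all add: regular_subdiff_def)
  then obtain a b where ab: "h x = ereal a" "g x = ereal b" by auto
  then show "\<bar>h x + g x\<bar> \<noteq> \<infinity>" by simp
  fix \<eta> :: real assume "\<eta> > 0"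
  then have h: "\<eta> / 2 > 0" by simp
  have "\<forall>\<^sub>F z in nhds x. h x + ereal (y1 \<bullet> (z - x) - \<eta> / 2 * norm (z - x)) \<le> h z"
    "\<forall>\<^sub>F z in nhds x. g x + ereal (y2 \<bullet> (z - x) - \<eta> / 2 * norm (z - x)) \<le> g z"
    using assms h unfolding regular_subdiff_iff by blast+
  then show "\<forall>\<^sub>F z in nhds x. h x + g x + ereal ((y1 + y2) \<bullet> (z - x) - \<eta> * norm (z - x)) \<le> h z + g z"
  proof eventually_elim
    case (elim z)
    show ?case using add_mono[OF elim] by (simp add: ab inner_add_left algebra_simps)
  qed
qed

lemma has_egradient_tendsto:
  assumes "has_egradient h D x"
  shows "(h \<longlongrightarrow> h x) (nhds x)"
proof -
  let ?h = "\<lambda>y. real_of_ereal (h y)"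
  have fin: "\<forall>\<^sub>F y in nhds x. \<bar>h y\<bar> \<noteq> \<infinity>" and "(?h has_derivative (\<lambda>d. d \<bullet> D)) (at x)"
    using assms by (auto simp: has_egradient_def gderiv_def)
  then have "isCont ?h x" using has_derivative_continuous by blast
  then have "(?h \<longlongrightarrow> ?h x) (nhds x)"
    unfolding continuous_at by (rule tendsto_at_iff_tendsto_nhds[THEN iffD1])
  then have "((\<lambda>y. ereal (?h y)) \<longlongrightarrow> ereal (?h x)) (nhds x)" by simp
  then show ?thesis
    using eventually_nhds_x_imp_x[OF fin]
    by (rule_tac Lim_transform_eventually) (auto intro: eventually_mono[OF fin] simp: ereal_real)
qed

text \<open>Along a sequence \<open>xs k\<close> defining \<open>y\<close> as a limiting subgradient of \<open>g\<close>, the gradients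
  \<open>D (xs k)\<close> can be added to the regular subgradients of \<open>g\<close>. Differentiability in a whole
  neighbourhood is what makes these gradients available, and continuity of the gradient at \<open>x\<close>
  makes them converge to \<open>D x\<close>.\<close>

lemma limiting_subdiff_add_smooth:
  assumes y: "y \<in> limiting_subdiff g x"
    and h: "\<forall>\<^sub>F u in nhds x. has_egradient h (D u) u"
    and D: "(D \<longlongrightarrow> D x) (nhds x)"
  shows "D x + y \<in> limiting_subdiff (\<lambda>u. h u + g u) x"
proof -
  have hx: "has_egradient h (D x) x" using h by (rule eventually_nhds_x_imp_x)
  from y obtain xs ys where gx: "\<bar>g x\<bar> \<noteq> \<infinity>" and xs: "xs \<longlonglongrightarrow> x" and gxs: "(\<lambda>k. g (xs k)) \<longlonglongrightarrow> g x"
    and ys: "\<And>k. ys k \<in> regular_subdiff g (xs k)" "ys \<longlonglongrightarrow> y"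
    by (auto simp: limiting_subdiff_def)
  have "\<forall>\<^sub>F k in sequentially. has_egradient h (D (xs k)) (xs k)"
    using h xs unfolding filterlim_iff by blast
  \<comment> \<open>Finitely many terms may lie outside the neighbourhood where \<open>h\<close> is smooth; they are dropped.\<close>
  then obtain N where N: "\<And>k. k \<ge> N \<Longrightarrow> has_egradient h (D (xs k)) (xs k)"
    by (auto simp: eventually_sequentially)
  define zs where "zs k = xs (k + N)" for k
  have zs: "zs \<longlonglongrightarrow> x" unfolding zs_def using xs by (rule LIMSEQ_ignore_initial_segment)
  have hx': "\<bar>h x\<bar> \<noteq> \<infinity>"
    using hx eventually_nhds_x_imp_x[of "\<lambda>u. \<bar>h u\<bar> \<noteq> \<infinity>"] by (simp add: has_egradient_def)
  have "(\<lambda>k. h (zs k)) \<longlonglongrightarrow> h x"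
    by (rule filterlim_compose[OF has_egradient_tendsto[OF hx] zs])
  moreover have "(\<lambda>k. g (zs k)) \<longlonglongrightarrow> g x"
    unfolding zs_def using gxs by (rule LIMSEQ_ignore_initial_segment)
  ultimately have "(\<lambda>k. h (zs k) + g (zs k)) \<longlonglongrightarrow> h x + g x"
    using hx' gx by (intro tendsto_add_ereal) auto
  moreover have "(\<lambda>k. D (zs k) + ys (k + N)) \<longlonglongrightarrow> D x + y"
    by (intro tendsto_add filterlim_compose[OF D zs] LIMSEQ_ignore_initial_segment ys)
  moreover have "D (zs k) + ys (k + N) \<in> regular_subdiff (\<lambda>u. h u + g u) (zs k)" for k
    unfolding zs_def by (rule regular_subdiff_add[OF has_egradient_regular_subdiff[OF N] ys(1)]) simp
  moreover have "\<bar>h x + g x\<bar> \<noteq> \<infinity>" using hx' gx by (cases "h x"; cases "g x") auto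
  ultimately show ?thesis
    unfolding limiting_subdiff_def mem_Collect_eq using zs
    by (intro conjI exI[of _ zs] exI[of _ "\<lambda>k. D (zs k) + ys (k + N)"] allI) simp_all
qed

lemma has_egradient_compose_matrix:
  fixes A :: "real^'n^'m"
  assumes "has_egradient h D (A *v u)"
  shows "has_egradient (\<lambda>u. h (A *v u)) (transpose A *v D) u"
  unfolding has_egradient_def
proof
  have lin: "bounded_linear ((*v) A)" by (rule matrix_vector_mul_bounded_linear)
  have "((*v) A \<longlongrightarrow> A *v u) (nhds u)"
    using linear_continuous_at[OF lin] unfolding continuous_at
    by (rule tendsto_at_iff_tendsto_nhds[THEN iffD1])
  then show "\<forall>\<^sub>F y in nhds u. \<bar>h (A *v y)\<bar> \<noteq> \<infinity>"
    using assms unfolding has_egradient_def filterlim_iff by blast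
  have "((\<lambda>y. real_of_ereal (h y)) has_derivative (\<lambda>d. d \<bullet> D)) (at (A *v u))"
    using assms by (auto simp: has_egradient_def gderiv_def)
  from has_derivative_compose[OF bounded_linear_imp_has_derivative[OF lin] this]
  show "GDERIV (\<lambda>y. real_of_ereal (h (A *v y))) u :> transpose A *v D"
    unfolding gderiv_def by (simp add: dot_lmul_matrix inner_commute[of _ "D v* A"] inner_commute[of _ D])
qed

section \<open>Attainment of minima and a criterion for differentiability\<close>

lemma lsc_sequentially:
  assumes "lsc_at f z" "x \<longlonglongrightarrow> z" "(\<lambda>k. f (x k)) \<longlonglongrightarrow> l"
  shows "f z \<le> l"
proof (rule ccontr)
  assume "\<not> f z \<le> l"
  then obtain c where c: "l < c" "c < f z" using dense by (metis not_le)
  have "\<forall>\<^sub>F y in at z. c < f y"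
    using assms(1) c unfolding lsc_at_def le_Liminf_iff by blast
  then have "\<forall>\<^sub>F y in nhds z. c < f y" using c by (simp add: eventually_nhds_conv_at)
  then have "\<forall>\<^sub>F k in sequentially. c \<le> f (x k)"
    using assms(2) unfolding filterlim_iff by (meson eventually_mono less_imp_le)
  then have "c \<le> l" using assms(3) by (intro tendsto_lowerbound[of "\<lambda>k. f (x k)"]) auto
  with c show False by simp
qed

text \<open>A real continuous perturbation can be subtracted along a minimising sequence, which
  leaves a convergent sequence of values of \<open>f\<close> to which lower semicontinuity applies.\<close>

lemma lsc_attains_min:
  fixes f :: "'a::metric_space \<Rightarrow> ereal"
  assumes "lsc_fun f" "compact K" "K \<noteq> {}" "continuous_on K q"
  obtains z where "z \<in> K" "\<And>z'. z' \<in> K \<Longrightarrow> f z + ereal (q z) \<le> f z' + ereal (q z')"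
proof -
  let ?F = "\<lambda>z. f z + ereal (q z)"
  define m where "m = Inf (?F ` K)"
  obtain t where t: "\<And>n. t n \<in> ?F ` K" "t \<longlonglongrightarrow> m"
    using Inf_as_limit[of "?F ` K"] assms(3) by (auto simp: m_def)
  then have "\<forall>n. \<exists>x\<in>K. t n = ?F x" by blast
  then obtain x where x: "\<And>n. x n \<in> K" "\<And>n. t n = ?F (x n)" by metis
  obtain z s where z: "z \<in> K" "strict_mono s" "(x \<circ> s) \<longlonglongrightarrow> z"
    using assms(2) x(1) unfolding compact_def by blast
  have "(\<lambda>n. q (x (s n))) \<longlonglongrightarrow> q z"
    using continuous_on_tendsto_compose[OF assms(4) z(3)] z(1) x(1) by (simp add: comp_def)
  then have q: "(\<lambda>n. ereal (- q (x (s n)))) \<longlonglongrightarrow> ereal (- q z)"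
    by (intro tendsto_intros)
  have F: "(\<lambda>n. ?F (x (s n))) \<longlonglongrightarrow> m"
    using LIMSEQ_subseq_LIMSEQ[OF t(2) z(2)] by (simp add: comp_def x(2))
  have "(\<lambda>n. ?F (x (s n)) + ereal (- q (x (s n)))) \<longlonglongrightarrow> m + ereal (- q z)"
    by (rule tendsto_add_ereal_general1[OF _ F q]) simp
  moreover have "?F a + ereal (- q a) = f a" for a by (cases "f a") auto
  ultimately have "(\<lambda>n. f ((x \<circ> s) n)) \<longlonglongrightarrow> m + ereal (- q z)" by simp
  then have "f z \<le> m + ereal (- q z)"
    using assms(1) z(3) unfolding lsc_fun_def by (blast intro: lsc_sequentially)
  then have "?F z \<le> m" by (cases "f z"; cases m) auto
  then show ?thesis
    using that[OF z(1)] unfolding m_def by (meson INF_lower order_trans)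
qed

text \<open>Value functions of minimisation problems satisfy such two-sided estimates by testing each
  of two problems with the minimiser of the other.\<close>

lemma GDERIV_sandwich:
  fixes E :: "'a::real_inner \<Rightarrow> real"
  assumes "\<forall>\<^sub>F x' in nhds x. Lo x' \<bullet> (x' - x) \<le> E x' - E x \<and> E x' - E x \<le> Up x' \<bullet> (x' - x)"
    and Lo: "(Lo \<longlongrightarrow> G) (nhds x)" and Up: "(Up \<longlongrightarrow> G) (nhds x)"
  shows "GDERIV E x :> G"
  unfolding gderiv_def has_derivative_at_alt
proof (intro conjI allI impI)
  show "bounded_linear (\<lambda>h. h \<bullet> G)" by (rule bounded_linear_inner_left)
  fix e :: real assume "e > 0"
  have "\<forall>\<^sub>F x' in nhds x. norm (E x' - E x - (x' - x) \<bullet> G) \<le> e * norm (x' - x)"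
    using assms(1) tendstoD[OF Lo \<open>e > 0\<close>] tendstoD[OF Up \<open>e > 0\<close>]
  proof eventually_elim
    case (elim x')
    have cs: "\<bar>(B - G) \<bullet> (x' - x)\<bar> \<le> e * norm (x' - x)" if "dist B G < e" for B
      using Cauchy_Schwarz_ineq2[of "B - G" "x' - x"] that
      by (smt (verit) dist_norm mult_right_mono norm_ge_zero)
    show ?case using cs[OF elim(2)] cs[OF elim(3)] elim(1)
      by (simp add: inner_diff_left inner_commute[of G] abs_le_iff)
  qed
  then show "\<exists>d>0. \<forall>y. norm (y - x) < d \<longrightarrow> norm (E y - E x - (y - x) \<bullet> G) \<le> e * norm (y - x)"
    by (simp add: eventually_nhds_metric dist_norm)
qed

section \<open>Convex kernels: strong convexity at the origin and growth away from it\<close>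

text \<open>Taylor expansion to second order of \<open>p\<close> along the segment from \<open>x\<close> to \<open>y\<close>: the remainder is
  half the Hessian form at an intermediate point of \<open>S\<close>.\<close>

lemma strong_convexity_from_hessian:
  fixes p :: "'a::real_inner \<Rightarrow> real"
  assumes S: "convex S" "x \<in> S" "y \<in> S"
    and P: "\<And>x. x \<in> S \<Longrightarrow> GDERIV p x :> P x"
    and H: "\<And>x. x \<in> S \<Longrightarrow> (P has_derivative H x) (at x)"
    and bound: "\<And>x h. x \<in> S \<Longrightarrow> \<mu> * (norm h)\<^sup>2 \<le> h \<bullet> H x h"
  shows "p x + P x \<bullet> (y - x) + \<mu> / 2 * (norm (y - x))\<^sup>2 \<le> p y"
proof -
  define d where "d = y - x"
  define c where "c t = x + t *\<^sub>R d" for t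
  have cS: "c t \<in> S" if "0 \<le> t" "t \<le> 1" for t
  proof -
    have "c t = (1 - t) *\<^sub>R x + t *\<^sub>R y" by (simp add: c_def d_def algebra_simps)
    then show ?thesis using S that by (simp add: convex_alt)
  qed
  have c: "(c has_derivative (\<lambda>s. s *\<^sub>R d)) (at t)" for t
    unfolding c_def by (auto intro!: derivative_eq_intros)
  have D1: "((\<lambda>t. p (c t)) has_real_derivative P (c t) \<bullet> d) (at t)" if "0 \<le> t" "t \<le> 1" for t
    using has_derivative_compose[OF c P[OF cS[OF that], unfolded gderiv_def]]
    by (simp add: has_field_derivative_def inner_commute mult_commute_abs)
  have D2: "((\<lambda>t. P (c t) \<bullet> d) has_real_derivative d \<bullet> H (c t) d) (at t)"
    if "0 \<le> t" "t \<le> 1" for t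
  proof -
    note H' = H[OF cS[OF that]]
    have "((\<lambda>t. P (c t) \<bullet> d) has_derivative (\<lambda>s. H (c t) (s *\<^sub>R d) \<bullet> d)) (at t)"
      by (rule has_derivative_inner_left[OF has_derivative_compose[OF c H']])
    moreover have "H (c t) (s *\<^sub>R d) = s *\<^sub>R H (c t) d" for s
      using H' by (simp add: has_derivative_bounded_linear linear_simps(5))
    ultimately show ?thesis
      by (simp add: has_field_derivative_def inner_commute mult_commute_abs)
  qed
  let ?diff = "\<lambda>k::nat. if k = 0 then (\<lambda>t. p (c t)) else if k = 1 then (\<lambda>t. P (c t) \<bullet> d)
    else (\<lambda>t. d \<bullet> H (c t) d)"
  have "\<exists>t>0. t \<le> 1 \<and> p (c 1) = (\<Sum>k<2. ?diff k 0 / fact k * 1 ^ k) + ?diff 2 t / fact 2 * 1 ^ 2"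
    by (rule Maclaurin2) (auto simp: less_2_cases_iff D1 D2)
  then obtain t where t: "0 < t" "t \<le> 1" "p (c 1) = p (c 0) + P (c 0) \<bullet> d + d \<bullet> H (c t) d / 2"
    by (auto simp: numeral_2_eq_2)
  have "\<mu> * (norm d)\<^sup>2 \<le> d \<bullet> H (c t) d" using t cS by (intro bound) auto
  then show ?thesis using t(3) by (simp add: c_def d_def)
qed

text \<open>The quadratic form attains a positive minimum on the compact product of \<open>S\<close> with the unit
  sphere; homogeneity extends the bound to all vectors.\<close>

lemma pos_def_uniform_on_compact:
  fixes H :: "'a::topological_space \<Rightarrow> real^'m^'m"
  assumes "compact S" "continuous_on S H" "\<And>x. x \<in> S \<Longrightarrow> pos_def_matrix (H x)"
  obtains \<mu> where "\<mu> > 0" "\<And>x h. x \<in> S \<Longrightarrow> \<mu> * (norm h)\<^sup>2 \<le> h \<bullet> (H x *v h)"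
proof (cases "S = {}")
  case True
  then show ?thesis using that[of 1] by simp
next
  case False
  let ?K = "S \<times> sphere (0::real^'m) 1"
  let ?F = "\<lambda>(x, h). h \<bullet> (H x *v h)"
  obtain a :: "real^'m" where "norm a = 1" using vector_choose_size[of 1] by auto
  then have "?K \<noteq> {}" using False by auto
  have "continuous_on ?K (\<lambda>xh. H (fst xh))"
    by (rule continuous_on_compose2[OF assms(2) continuous_on_fst]) auto
  then have "continuous_on ?K (\<lambda>xh. H (fst xh) $ i $ j)" for i j
    by (intro continuous_on_component)
  moreover have "continuous_on ?K (\<lambda>xh. snd xh $ i)" for i
    by (rule continuous_on_component) (rule continuous_on_snd[OF continuous_on_id])
  ultimately have "continuous_on ?K (\<lambda>xh. \<Sum>i\<in>UNIV. snd xh $ i * (\<Sum>j\<in>UNIV. H (fst xh) $ i $ j * snd xh $ j))"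
    by (intro continuous_on_sum continuous_on_mult)
  then have "continuous_on ?K (\<lambda>xh. snd xh \<bullet> (H (fst xh) *v snd xh))"
    by (simp add: inner_vec_def matrix_vector_mult_def)
  from continuous_attains_inf[OF compact_Times[OF assms(1) compact_sphere] \<open>?K \<noteq> {}\<close> this]
  obtain xh where xh: "xh \<in> ?K"
    "\<And>z. z \<in> ?K \<Longrightarrow> snd xh \<bullet> (H (fst xh) *v snd xh) \<le> snd z \<bullet> (H (fst z) *v snd z)"
    by blast
  define \<mu> where "\<mu> = snd xh \<bullet> (H (fst xh) *v snd xh)"
  have "fst xh \<in> S" "norm (snd xh) = 1" using xh(1) by auto
  then have "\<mu> > 0"
    using assms(3)[of "fst xh"] unfolding pos_def_matrix_def \<mu>_def by (metis norm_zero zero_neq_one)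
  moreover have "\<mu> * (norm h)\<^sup>2 \<le> h \<bullet> (H x *v h)" if "x \<in> S" for x h
  proof (cases "h = 0")
    case False
    let ?e = "(1 / norm h) *\<^sub>R h"
    have "\<mu> \<le> ?e \<bullet> (H x *v ?e)"
      using xh(2)[of "(x, ?e)"] that False by (simp add: \<mu>_def)
    also have "\<dots> = (h \<bullet> (H x *v h)) / (norm h)\<^sup>2"
      by (simp add: matrix_vector_mult_scaleR power2_eq_square)
    finally show ?thesis using False by (simp add: field_simps)
  qed simp
  ultimately show ?thesis using that by blast
qed

lemma strongly_convex_near_origin:
  fixes \<phi> :: "real^'m \<Rightarrow> ereal"
  assumes dom: "open (edom \<phi>)" "0 \<in> edom \<phi>"
    and C2: "twice_cont_diff_on (edom \<phi>) \<phi>"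
    and H: "\<forall>w\<in>edom \<phi>. pos_def_matrix (ehessian \<phi> w)"
  obtains R \<mu> where "R > 0" "\<mu> > 0" "cball 0 R \<subseteq> edom \<phi>"
    "\<And>x y. norm x \<le> R \<Longrightarrow> norm y \<le> R \<Longrightarrow> real_of_ereal (\<phi> x) + egrad \<phi> x \<bullet> (y - x)
       + \<mu> / 2 * (norm (y - x))\<^sup>2 \<le> real_of_ereal (\<phi> y)"
proof -
  obtain R where R: "R > 0" "cball 0 R \<subseteq> edom \<phi>"
    using dom open_contains_cball by metis
  have grad: "has_egradient \<phi> (egrad \<phi> x) x" if "x \<in> edom \<phi>" for x
    using C2 that egrad_eq unfolding twice_cont_diff_on_def edifferentiable_def by blast
  have cont: "continuous_on (cball 0 R) (ehessian \<phi>)"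
    using C2 R(2) continuous_on_subset unfolding twice_cont_diff_on_def by blast
  have H': "\<And>x. x \<in> cball 0 R \<Longrightarrow> pos_def_matrix (ehessian \<phi> x)" using H R(2) by blast
  obtain \<mu> where \<mu>: "\<mu> > 0" "\<And>x h. x \<in> cball 0 R \<Longrightarrow> \<mu> * (norm h)\<^sup>2 \<le> h \<bullet> (ehessian \<phi> x *v h)"
    using pos_def_uniform_on_compact[OF compact_cball cont H'] by blast
  show ?thesis
  proof (rule that[OF R(1) \<mu>(1) R(2)])
    fix x y :: "real^'m" assume xy: "norm x \<le> R" "norm y \<le> R"
    show "real_of_ereal (\<phi> x) + egrad \<phi> x \<bullet> (y - x) + \<mu> / 2 * (norm (y - x))\<^sup>2 \<le> real_of_ereal (\<phi> y)"
    proof (rule strong_convexity_from_hessian[where S = "cball 0 R" and H = "\<lambda>x h. ehessian \<phi> x *v h"])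
      fix x assume "x \<in> cball (0::real^'m) R"
      then have x: "x \<in> edom \<phi>" using R(2) by blast
      show "GDERIV (\<lambda>y. real_of_ereal (\<phi> y)) x :> egrad \<phi> x"
        using grad[OF x] by (simp add: has_egradient_def)
      have "egrad \<phi> differentiable (at x)" using C2 x unfolding twice_cont_diff_on_def by blast
      then show "(egrad \<phi> has_derivative (\<lambda>h. ehessian \<phi> x *v h)) (at x)"
        unfolding ehessian_def jacobian_works .
    qed (use xy \<mu> in auto)
  qed
qed

lemma convex_fun_scale:
  fixes \<phi> :: "'a::real_vector \<Rightarrow> ereal"
  assumes "convex_fun \<phi>" "\<phi> 0 = 0" "\<phi> x = ereal a" "0 \<le> s" "s \<le> 1"
  shows "\<phi> (s *\<^sub>R x) \<le> ereal (s * a)"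
proof -
  let ?E = "{(z, r::real). \<phi> z \<le> ereal r}"
  have "(0, 0) \<in> ?E" "(x, a) \<in> ?E" using assms(2,3) by (simp_all add: zero_ereal_def)
  from convexD_alt[OF assms(1)[unfolded convex_fun_def] this assms(4,5)]
  show ?thesis by simp
qed

text \<open>Quadratic growth on a ball becomes linear growth outside it: compare \<open>x\<close> with the point of
  norm \<open>s\<close> on the segment from the origin to \<open>x\<close>, where the value is at least \<open>\<mu>/2 s\<^sup>2\<close>.\<close>

lemma convex_fun_linear_growth:
  fixes \<phi> :: "'a::real_inner \<Rightarrow> ereal"
  assumes "convex_fun \<phi>" "\<phi> 0 = 0" "\<phi> x \<noteq> - \<infinity>"
    and near: "\<And>y. norm y \<le> R \<Longrightarrow> ereal (\<mu> / 2 * (norm y)\<^sup>2) \<le> \<phi> y"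
    and s: "0 < s" "s \<le> R" "s \<le> norm x"
  shows "ereal (\<mu> * s / 2 * norm x) \<le> \<phi> x"
proof (cases "\<phi> x")
  case (real a)
  define t where "t = s / norm x"
  have "norm x > 0" using s by linarith
  then have t: "0 < t" "t \<le> 1" "t * norm x = s" using s by (auto simp: t_def)
  have "ereal (\<mu> / 2 * (norm (t *\<^sub>R x))\<^sup>2) \<le> \<phi> (t *\<^sub>R x)"
    using t s by (intro near) simp
  also have "\<dots> \<le> ereal (t * a)" using t by (intro convex_fun_scale assms real) auto
  finally have "\<mu> / 2 * s\<^sup>2 \<le> t * a" using t by simp
  then have "t * (\<mu> * s / 2 * norm x) \<le> t * a"
    by (simp flip: t(3) add: power2_eq_square mult_ac)
  then show ?thesis using t by (simp add: real)
qed (use assms in auto)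

text \<open>This is the subgradient inequality at \<open>w\<close> tested at the origin. On the segment from \<open>0\<close> to \<open>w\<close>,
  \<open>t \<mapsto> \<phi>(t w) - t \<phi> w\<close> is nonpositive and vanishes at \<open>t = 1\<close>, so its derivative there,
  \<open>D \<bullet> w - \<phi> w\<close>, cannot be negative.\<close>

lemma convex_fun_gradient_bound:
  fixes \<phi> :: "'a::real_inner \<Rightarrow> ereal"
  assumes "convex_fun \<phi>" "\<phi> 0 = 0" "\<And>x. \<phi> x \<noteq> - \<infinity>" and D: "has_egradient \<phi> D w"
  shows "real_of_ereal (\<phi> w) \<le> D \<bullet> w"
proof (rule ccontr)
  let ?p = "\<lambda>x. real_of_ereal (\<phi> x)"
  assume neg: "\<not> ?p w \<le> D \<bullet> w"
  have "\<bar>\<phi> w\<bar> \<noteq> \<infinity>"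
    using D eventually_nhds_x_imp_x[of "\<lambda>u. \<bar>\<phi> u\<bar> \<noteq> \<infinity>"] by (simp add: has_egradient_def)
  then have w: "\<phi> w = ereal (?p w)" by (simp add: ereal_real)
  have "((\<lambda>t. t *\<^sub>R w) has_derivative (\<lambda>s. s *\<^sub>R w)) (at 1)"
    by (auto intro!: derivative_eq_intros)
  moreover have "(?p has_derivative (\<lambda>h. h \<bullet> D)) (at (1 *\<^sub>R w))"
    using D by (simp add: has_egradient_def gderiv_def)
  ultimately have "((\<lambda>t. ?p (t *\<^sub>R w)) has_real_derivative D \<bullet> w) (at 1)"
    using has_derivative_compose[of "\<lambda>t. t *\<^sub>R w" "\<lambda>s. s *\<^sub>R w" 1 UNIV ?p "\<lambda>h. h \<bullet> D"]
    by (simp add: has_field_derivative_def inner_commute mult_commute_abs)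
  then have "((\<lambda>t. ?p (t *\<^sub>R w) - t * ?p w) has_real_derivative D \<bullet> w - ?p w) (at 1)"
    by (auto intro!: derivative_eq_intros)
  from DERIV_neg_dec_left[OF this] neg
  obtain d where d: "d > 0" "\<And>h. 0 < h \<Longrightarrow> h < d \<Longrightarrow> 0 < ?p ((1 - h) *\<^sub>R w) - (1 - h) * ?p w"
    by auto
  define h where "h = min (d / 2) 1"
  have h: "0 < h" "h < d" "h \<le> 1" using d(1) by (auto simp: h_def)
  have "\<phi> ((1 - h) *\<^sub>R w) \<le> ereal ((1 - h) * ?p w)"
    using h by (intro convex_fun_scale assms w) auto
  then have "?p ((1 - h) *\<^sub>R w) \<le> (1 - h) * ?p w"
    using assms(3)[of "(1 - h) *\<^sub>R w"] by (cases "\<phi> ((1 - h) *\<^sub>R w)") auto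
  with d(2)[OF h(1,2)] show False by simp
qed

section \<open>Inf-convolution of a prox-regular function with a strongly convex kernel\<close>

text \<open>The kernel \<open>\<psi>\<close> (later \<open>\<phi>/\<lambda>\<close>) is described only on the ball of radius \<open>R\<close>, by a real function
  \<open>q\<close> with gradient \<open>Q\<close>; outside this ball it enters only through \<open>far\<close>, which confines all
  minimisers for \<open>v\<close> near \<open>vb\<close> to the ball of radius \<open>\<delta>\<close> around \<open>v\<close>. That \<open>Q\<close> is the gradient
  of \<open>q\<close> is expressed by the strong convexity inequality and the continuity of \<open>Q\<close>. The radii
  are chosen so that for \<open>\<parallel>v - zb\<parallel> < \<delta>\<close> and \<open>\<parallel>z - zb\<parallel> < 2 \<delta>\<close> the difference \<open>v - z\<close> stays in the
  ball of radius \<open>R\<close> and \<open>z\<close> within reach of prox-regularity. The inequality \<open>r < m\<close> says that the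
  curvature of the kernel dominates the lack of convexity of \<open>f\<close>.\<close>

locale local_prox_regular_convolution =
  fixes f \<psi> :: "'a::euclidean_space \<Rightarrow> ereal" and q :: "'a \<Rightarrow> real" and Q :: "'a \<Rightarrow> 'a"
    and R m L r \<delta> \<epsilon> :: real and zb vb :: 'a
  assumes f: "proper_fun f" "lsc_fun f"
    and \<psi>: "\<And>x. norm x < R \<Longrightarrow> \<psi> x = ereal (q x)"
    and strong: "\<And>x y. norm x < R \<Longrightarrow> norm y < R \<Longrightarrow>
      q x + Q x \<bullet> (y - x) + m / 2 * (norm (y - x))\<^sup>2 \<le> q y"
    and Q_cont: "continuous_on (ball 0 R) Q"
    and Q_bound: "\<And>x. norm x < R \<Longrightarrow> norm (Q x) \<le> L"
    and radii: "3 * \<delta> \<le> R" "2 * \<delta> \<le> \<epsilon>"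
    and near: "norm (vb - zb) < \<delta>"
    and zb: "\<bar>f zb\<bar> \<noteq> \<infinity>" "Q (vb - zb) \<in> limiting_subdiff f zb"
    and regular: "\<And>z' z y. \<lbrakk>norm (z' - zb) < \<epsilon>; norm (z - zb) < \<epsilon>; f z - f zb < ereal \<epsilon>;
        y \<in> limiting_subdiff f z; norm (y - Q (vb - zb)) < \<epsilon>\<rbrakk> \<Longrightarrow>
      f z + ereal (y \<bullet> (z' - z) - r / 2 * (norm (z' - z))\<^sup>2) \<le> f z'"
    and r: "0 \<le> r" "r < m"
    and far: "\<forall>\<^sub>F v in nhds vb. \<forall>z. \<delta> \<le> norm (v - z) \<longrightarrow> f zb + \<psi> (v - zb) < f z + \<psi> (v - z)"
begin

definition envelope :: "'a \<Rightarrow> ereal" where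
  "envelope v = (INF z. f z + \<psi> (v - z))"

definition is_prox :: "'a \<Rightarrow> 'a \<Rightarrow> bool" where
  "is_prox v z \<longleftrightarrow> (\<forall>z'. f z + \<psi> (v - z) \<le> f z' + \<psi> (v - z'))"

definition well_placed :: "'a \<Rightarrow> bool" where
  "well_placed v \<longleftrightarrow> norm (v - zb) < \<delta> \<and>
     (\<forall>z. \<delta> \<le> norm (v - z) \<longrightarrow> f zb + \<psi> (v - zb) < f z + \<psi> (v - z))"

definition growth_at :: "'a \<Rightarrow> 'a \<Rightarrow> bool" where
  "growth_at v z \<longleftrightarrow> \<bar>f z\<bar> \<noteq> \<infinity> \<and> norm (z - zb) < 2 * \<delta> \<and>
     (\<forall>z'. norm (z' - zb) < 2 * \<delta> \<longrightarrow>
        f z + ereal (q (v - z) + (m - r) / 2 * (norm (z' - z))\<^sup>2) \<le> f z' + ereal (q (v - z')))"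

lemma \<delta>_pos: "0 < \<delta>" using near norm_ge_zero[of "vb - zb"] by linarith

lemma \<epsilon>_pos: "0 < \<epsilon>" using \<delta>_pos radii by linarith

lemma L_nonneg: "0 \<le> L"
proof -
  have "norm (Q 0) \<le> L" using \<delta>_pos radii by (intro Q_bound) simp
  then show ?thesis using norm_ge_zero[of "Q 0"] by linarith
qed

lemma f_not_MInf: "f z \<noteq> - \<infinity>"
  using f(1) unfolding proper_fun_def by (metis less_irrefl)

lemma gradient_inequality:
  assumes "norm x < R" "norm y < R"
  shows "q x + Q x \<bullet> (y - x) \<le> q y"
proof -
  have "0 \<le> m / 2 * (norm (y - x))\<^sup>2" using r by simp
  then show ?thesis using strong[OF assms] by linarith
qed

lemma q_lipschitz:
  assumes "norm x < R" "norm y < R"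
  shows "q x - q y \<le> L * norm (x - y)"
proof -
  have "q x - q y \<le> Q x \<bullet> (x - y)"
    using gradient_inequality[OF assms] by (simp add: inner_diff_right)
  also have "\<dots> \<le> norm (Q x) * norm (x - y)" by (rule norm_cauchy_schwarz)
  also have "\<dots> \<le> L * norm (x - y)" using Q_bound[OF assms(1)] by (rule mult_right_mono) simp
  finally show ?thesis .
qed

lemma Q_tendsto:
  assumes "norm x < R" "(g \<longlongrightarrow> x) F"
  shows "((\<lambda>t. Q (g t)) \<longlongrightarrow> Q x) F"
proof -
  have "isCont Q x"
    using Q_cont assms(1) by (simp add: continuous_on_eq_continuous_at)
  then show ?thesis using assms(2) by (rule isCont_tendsto_compose)
qed

lemma kernel_range:
  assumes "norm (v - zb) < \<delta>" "norm (z - zb) < 2 * \<delta>"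
  shows "norm (v - z) < R"
proof -
  have "norm (v - z) \<le> norm (v - zb) + norm (z - zb)"
    using norm_triangle_ineq4[of "v - zb" "z - zb"] by simp
  then show ?thesis using assms radii by linarith
qed

lemma well_placed_near: "well_placed v \<Longrightarrow> norm (v - zb) < \<delta>"
  by (simp add: well_placed_def)

lemma eventually_well_placed: "\<forall>\<^sub>F v in nhds vb. well_placed v"
proof -
  have "((\<lambda>v. norm (v - zb)) \<longlongrightarrow> norm (vb - zb)) (nhds vb)"
    by (intro tendsto_intros filterlim_ident)
  then have "\<forall>\<^sub>F v in nhds vb. norm (v - zb) < \<delta>"
    using near by (rule order_tendstoD)
  with far show ?thesis unfolding well_placed_def by eventually_elim simp
qed

lemma is_prox_props:
  assumes v: "well_placed v" and z: "is_prox v z"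
  shows "norm (v - z) < \<delta>" "norm (z - zb) < 2 * \<delta>" "\<bar>f z\<bar> \<noteq> \<infinity>"
    "envelope v = f z + ereal (q (v - z))"
proof -
  have le: "f z + \<psi> (v - z) \<le> f zb + \<psi> (v - zb)" using z by (simp add: is_prox_def)
  then show n: "norm (v - z) < \<delta>"
    using v unfolding well_placed_def by (metis linorder_not_le)
  have "norm (z - zb) \<le> norm (v - zb) + norm (v - z)"
    using norm_triangle_ineq4[of "v - zb" "v - z"] by simp
  then show "norm (z - zb) < 2 * \<delta>" using n well_placed_near[OF v] by linarith
  have "norm (v - z) < R" "norm (v - zb) < R"
    using n well_placed_near[OF v] radii \<delta>_pos by linarith+
  then have \<psi>': "\<psi> (v - z) = ereal (q (v - z))" "\<psi> (v - zb) = ereal (q (v - zb))" using \<psi> by blast+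
  show "\<bar>f z\<bar> \<noteq> \<infinity>" using le zb(1) f_not_MInf[of z] unfolding \<psi>' by (cases "f z"; cases "f zb") auto
  have "envelope v = f z + \<psi> (v - z)"
    unfolding envelope_def using z by (intro antisym INF_lower INF_greatest) (auto simp: is_prox_def)
  then show "envelope v = f z + ereal (q (v - z))" by (simp add: \<psi>')
qed

lemma is_prox_exists:
  assumes v: "well_placed v"
  shows "\<exists>z. is_prox v z"
proof -
  let ?K = "cball v \<delta>"
  have inK: "norm (v - z) < R" if "z \<in> ?K" for z
    using that radii \<delta>_pos by (auto simp: dist_norm)
  have q_cont: "continuous_on (ball 0 R) q"
  proof (rule lipschitz_on_continuous_on[of L], rule lipschitz_onI)
    fix x y :: 'a assume "x \<in> ball 0 R" "y \<in> ball (0::'a) R"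
    then show "dist (q x) (q y) \<le> L * dist x y"
      using q_lipschitz[of x y] q_lipschitz[of y x] by (simp add: dist_norm abs_le_iff norm_minus_commute)
  qed (rule L_nonneg)
  have cont: "continuous_on ?K (\<lambda>z. q (v - z))"
    by (rule continuous_on_compose2[OF q_cont]) (auto intro!: continuous_intros inK)
  obtain z where z: "z \<in> ?K" "\<And>z'. z' \<in> ?K \<Longrightarrow> f z + ereal (q (v - z)) \<le> f z' + ereal (q (v - z'))"
    using lsc_attains_min[OF f(2) compact_cball _ cont] \<delta>_pos by auto
  then have inK': "f z + \<psi> (v - z) \<le> f z' + \<psi> (v - z')" if "z' \<in> ?K" for z'
    using that by (simp add: \<psi> inK)
  have "zb \<in> ?K" using well_placed_near[OF v] by (simp add: dist_norm)
  have "f z + \<psi> (v - z) \<le> f z' + \<psi> (v - z')" for z'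
  proof (cases "z' \<in> ?K")
    case False
    then have "f zb + \<psi> (v - zb) < f z' + \<psi> (v - z')"
      using v by (auto simp: well_placed_def dist_norm)
    then show ?thesis using inK'[OF \<open>zb \<in> ?K\<close>] by order
  qed (rule inK')
  then show ?thesis by (auto simp: is_prox_def)
qed

text \<open>Fermat's rule: minimality at \<open>z\<close> gives \<open>f x - f z \<ge> q (v - z) - q (v - x)\<close>, and convexity bounds
  the right-hand side below by \<open>Q (v - x) \<bullet> (x - z)\<close>, where \<open>Q (v - x)\<close> is close to \<open>Q (v - z)\<close>.\<close>

lemma is_prox_subgradient:
  assumes v: "well_placed v" and z: "is_prox v z"
  shows "Q (v - z) \<in> regular_subdiff f z"
  unfolding regular_subdiff_iff
proof (intro conjI allI impI)
  note p = is_prox_props[OF v z]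
  show "\<bar>f z\<bar> \<noteq> \<infinity>" by (rule p)
  have vz: "norm (v - z) < R" using p(1) radii \<delta>_pos by linarith
  fix \<eta> :: real assume "\<eta> > 0"
  have lim: "((\<lambda>x. v - x) \<longlongrightarrow> v - z) (nhds z)" by (intro tendsto_intros filterlim_ident)
  have "\<forall>\<^sub>F x in nhds z. norm (v - x) < R"
    using tendsto_norm[OF lim] vz by (rule order_tendstoD)
  moreover have "\<forall>\<^sub>F x in nhds z. dist (Q (v - x)) (Q (v - z)) < \<eta>"
    using Q_tendsto[OF vz lim] \<open>\<eta> > 0\<close> by (rule tendstoD)
  ultimately show "\<forall>\<^sub>F x in nhds z. f z + ereal (Q (v - z) \<bullet> (x - z) - \<eta> * norm (x - z)) \<le> f x"
  proof eventually_elim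
    case (elim x)
    have "f z + ereal (q (v - z)) \<le> f x + ereal (q (v - x))"
      using z vz elim(1) unfolding is_prox_def by (metis \<psi>)
    moreover have "q (v - x) + Q (v - x) \<bullet> (x - z) \<le> q (v - z)"
      using gradient_inequality[OF elim(1) vz] by simp
    moreover have "(Q (v - z) - Q (v - x)) \<bullet> (x - z) \<le> norm (Q (v - z) - Q (v - x)) * norm (x - z)"
      by (rule norm_cauchy_schwarz)
    moreover have "\<dots> \<le> \<eta> * norm (x - z)"
      using elim(2) by (intro mult_right_mono) (auto simp: dist_norm norm_minus_commute)
    ultimately show ?case
      using p(3) by (cases "f z"; cases "f x") (auto simp: inner_diff_left)
  qed
qed

text \<open>Prox-regularity with the subgradient \<open>Q (v - z)\<close> and strong convexity of \<open>q\<close> at \<open>v - z\<close> have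
  opposite linear terms, so their sum is purely quadratic with coefficient \<open>(m - r)/2\<close>.\<close>

lemma growth_from_prox_regularity:
  assumes v: "norm (v - zb) < \<delta>" and z: "norm (z - zb) < 2 * \<delta>" "\<bar>f z\<bar> \<noteq> \<infinity>"
    and y: "Q (v - z) \<in> limiting_subdiff f z" "f z - f zb < ereal \<epsilon>"
      "norm (Q (v - z) - Q (vb - zb)) < \<epsilon>"
  shows "growth_at v z"
  unfolding growth_at_def
proof (intro conjI allI impI z)
  fix z' assume z': "norm (z' - zb) < 2 * \<delta>"
  have "f z + ereal (Q (v - z) \<bullet> (z' - z) - r / 2 * (norm (z' - z))\<^sup>2) \<le> f z'"
    using z z' y radii by (intro regular) auto
  moreover have "q (v - z) - Q (v - z) \<bullet> (z' - z) + m / 2 * (norm (z' - z))\<^sup>2 \<le> q (v - z')"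
    using strong[OF kernel_range[OF v z(1)] kernel_range[OF v z']]
    by (simp add: inner_diff_right norm_minus_commute)
  ultimately show "f z + ereal (q (v - z) + (m - r) / 2 * (norm (z' - z))\<^sup>2) \<le> f z' + ereal (q (v - z'))"
    using z(2) by (cases "f z"; cases "f z'") (auto simp: algebra_simps diff_divide_distrib)
qed

lemma growth_at_centre: "growth_at vb zb"
  using near zb \<delta>_pos \<epsilon>_pos by (intro growth_from_prox_regularity) auto

text \<open>Growth at \<open>v0\<close> bounds the distance of \<open>z\<close> from \<open>z0\<close> by the excess of the value of \<open>z\<close> in the problem
  for \<open>v0\<close>. As \<open>z\<close> is optimal for \<open>v\<close>, this excess comes only from exchanging \<open>v\<close> and \<open>v0\<close> in two
  kernel terms, each costing at most \<open>L \<parallel>v - v0\<parallel>\<close>. Applied at the centre with \<open>v = v0\<close> it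
  yields that \<open>zb\<close> is the minimiser for \<open>vb\<close>.\<close>

lemma prox_Hoelder:
  assumes v0: "well_placed v0" and g: "growth_at v0 z0" and v: "well_placed v" and z: "is_prox v z"
  shows "(m - r) / 2 * (norm (z - z0))\<^sup>2 \<le> 2 * L * norm (v - v0)"
proof -
  note p = is_prox_props[OF v z] and near' = well_placed_near[OF v0] well_placed_near[OF v]
  have z0: "\<bar>f z0\<bar> \<noteq> \<infinity>" "norm (z0 - zb) < 2 * \<delta>" using g by (auto simp: growth_at_def)
  note R = kernel_range[OF near'(1) z0(2)] kernel_range[OF near'(1) p(2)]
    kernel_range[OF near'(2) z0(2)] kernel_range[OF near'(2) p(2)]
  have "f z0 + ereal (q (v0 - z0) + (m - r) / 2 * (norm (z - z0))\<^sup>2) \<le> f z + ereal (q (v0 - z))"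
    using g p(2) by (simp add: growth_at_def)
  moreover have "f z + ereal (q (v - z)) \<le> f z0 + ereal (q (v - z0))"
    using z R unfolding is_prox_def by (metis \<psi>)
  moreover have "q (v0 - z) - q (v - z) \<le> L * norm (v - v0)"
    using q_lipschitz[OF R(2,4)] by (simp add: norm_minus_commute)
  moreover have "q (v - z0) - q (v0 - z0) \<le> L * norm (v - v0)"
    using q_lipschitz[OF R(3,1)] by simp
  ultimately show ?thesis
    using p(3) z0(1) by (cases "f z"; cases "f z0") auto
qed

definition prox :: "'a \<Rightarrow> 'a" where
  "prox v = (SOME z. is_prox v z)"

lemma is_prox_prox: "well_placed v \<Longrightarrow> is_prox v (prox v)"
  unfolding prox_def by (rule someI_ex[OF is_prox_exists])

lemma prox_tendsto:
  assumes g: "growth_at v0 z0" and ev: "\<forall>\<^sub>F v in nhds v0. well_placed v"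
  shows "(prox \<longlongrightarrow> z0) (nhds v0)"
proof -
  have v0: "well_placed v0" using ev by (rule eventually_nhds_x_imp_x)
  have lim: "((\<lambda>v. sqrt (4 * L / (m - r) * norm (v - v0))) \<longlongrightarrow> sqrt (4 * L / (m - r) * norm (v0 - v0))) (nhds v0)"
    by (intro tendsto_intros filterlim_ident)
  show ?thesis
  proof (rule tendsto_dist_iff[THEN iffD2], rule tendsto_sandwich[where f = "\<lambda>_. 0"])
    show "\<forall>\<^sub>F v in nhds v0. dist (prox v) z0 \<le> sqrt (4 * L / (m - r) * norm (v - v0))"
      using ev
    proof eventually_elim
      case (elim v)
      then have "(m - r) / 2 * (norm (prox v - z0))\<^sup>2 \<le> 2 * L * norm (v - v0)"
        by (intro prox_Hoelder v0 g is_prox_prox)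
      then have "(norm (prox v - z0))\<^sup>2 \<le> 4 * L / (m - r) * norm (v - v0)"
        using r by (simp add: field_simps)
      then show ?case by (simp add: dist_norm real_le_rsqrt)
    qed
    show "((\<lambda>v. sqrt (4 * L / (m - r) * norm (v - v0))) \<longlongrightarrow> 0) (nhds v0)" using lim by simp
  qed auto
qed

lemma prox_centre: "prox vb = zb"
proof -
  have "well_placed vb" using eventually_well_placed by (rule eventually_nhds_x_imp_x)
  then have "(m - r) / 2 * (norm (prox vb - zb))\<^sup>2 \<le> 2 * L * norm (vb - vb)"
    by (intro prox_Hoelder growth_at_centre is_prox_prox)
  then show ?thesis using r by (simp add: mult_le_0_iff)
qed

lemma kernel_gradient_tendsto:
  assumes "growth_at v0 z0" "\<forall>\<^sub>F v in nhds v0. well_placed v"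
  shows "((\<lambda>v. Q (v0 - prox v)) \<longlongrightarrow> Q (v0 - z0)) (nhds v0)"
    and "((\<lambda>v. Q (v - prox v)) \<longlongrightarrow> Q (v0 - z0)) (nhds v0)"
    and "((\<lambda>v. Q (v - z0)) \<longlongrightarrow> Q (v0 - z0)) (nhds v0)"
proof -
  have "norm (v0 - z0) < R"
    using assms eventually_nhds_x_imp_x[OF assms(2)]
    by (intro kernel_range) (auto simp: growth_at_def well_placed_def)
  note Q_lim = Q_tendsto[OF this]
  show "((\<lambda>v. Q (v0 - prox v)) \<longlongrightarrow> Q (v0 - z0)) (nhds v0)"
    "((\<lambda>v. Q (v - prox v)) \<longlongrightarrow> Q (v0 - z0)) (nhds v0)"
    "((\<lambda>v. Q (v - z0)) \<longlongrightarrow> Q (v0 - z0)) (nhds v0)"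
    by (intro Q_lim tendsto_intros filterlim_ident prox_tendsto[OF assms])+
qed

text \<open>Prox-regularity can be used at \<open>prox v\<close> only once \<open>prox v\<close>, its function value and its
  subgradient are close to those at \<open>zb\<close>. Growth at the centre gives the first by continuity, the
  second from optimality, and the third from continuity of \<open>Q\<close>.\<close>

lemma eventually_growth: "\<forall>\<^sub>F v in nhds vb. growth_at v (prox v)"
proof -
  note lim = prox_tendsto[OF growth_at_centre eventually_well_placed]
  have "((\<lambda>v. L * norm (prox v - zb)) \<longlongrightarrow> L * norm (zb - zb)) (nhds vb)"
    by (intro tendsto_intros lim)
  then have "\<forall>\<^sub>F v in nhds vb. L * norm (prox v - zb) < \<epsilon>"
    by (rule order_tendstoD) (use \<epsilon>_pos in simp)
  moreover have "\<forall>\<^sub>F v in nhds vb. dist (Q (v - prox v)) (Q (vb - zb)) < \<epsilon>"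
    by (rule tendstoD[OF kernel_gradient_tendsto(2)[OF growth_at_centre eventually_well_placed] \<epsilon>_pos])
  ultimately show ?thesis
    using eventually_well_placed
  proof eventually_elim
    case (elim v)
    note z = is_prox_prox[OF elim(3)] and near' = well_placed_near[OF elim(3)]
    note p = is_prox_props[OF elim(3) z]
    have R: "norm (v - prox v) < R" "norm (v - zb) < R"
      using kernel_range[OF near'] p(2) \<delta>_pos by simp_all
    have "f (prox v) + ereal (q (v - prox v)) \<le> f zb + ereal (q (v - zb))"
      using z R unfolding is_prox_def by (metis \<psi>)
    moreover have "q (v - zb) - q (v - prox v) \<le> L * norm (prox v - zb)"
      using q_lipschitz[OF R(2,1)] by simp
    ultimately have "f (prox v) - f zb < ereal \<epsilon>"
      using elim(1) p(3) zb(1) by (cases "f (prox v)"; cases "f zb") auto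
    then show ?case
      using elim(2) near' p regular_subdiff_subset_limiting is_prox_subgradient[OF elim(3) z]
      by (intro growth_from_prox_regularity) (auto simp: dist_norm)
  qed
qed

text \<open>Testing the problem for \<open>v\<close> with \<open>prox v0\<close> and the problem for \<open>v0\<close> with \<open>prox v\<close> brackets the
  increment of the envelope between increments of \<open>q\<close>, which convexity bounds by \<open>Q\<close> at the
  displaced arguments. Both bounds converge to the same gradient because \<open>prox\<close> is continuous
  at \<open>v0\<close>.\<close>

lemma envelope_has_egradient:
  assumes g: "growth_at v0 (prox v0)" and ev: "\<forall>\<^sub>F v in nhds v0. well_placed v"
  shows "has_egradient envelope (Q (v0 - prox v0)) v0"
  unfolding has_egradient_def
proof
  have v0: "well_placed v0" using ev by (rule eventually_nhds_x_imp_x)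
  note z0 = is_prox_prox[OF v0] and near0 = well_placed_near[OF v0]
  note p0 = is_prox_props[OF v0 z0]
  show "\<forall>\<^sub>F v in nhds v0. \<bar>envelope v\<bar> \<noteq> \<infinity>"
    using ev
  proof eventually_elim
    case (elim v)
    show ?case using is_prox_props(3,4)[OF elim is_prox_prox[OF elim]] by auto
  qed
  let ?E = "\<lambda>v. real_of_ereal (envelope v)"
  have "\<forall>\<^sub>F v in nhds v0. Q (v0 - prox v) \<bullet> (v - v0) \<le> ?E v - ?E v0 \<and>
      ?E v - ?E v0 \<le> Q (v - prox v0) \<bullet> (v - v0)"
    using ev
  proof eventually_elim
    case (elim v)
    note z = is_prox_prox[OF elim] and near' = well_placed_near[OF elim]
    note p = is_prox_props[OF elim z]
    note R = kernel_range[OF near0 p0(2)] kernel_range[OF near0 p(2)]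
      kernel_range[OF near' p0(2)] kernel_range[OF near' p(2)]
    obtain a b where ab: "f (prox v0) = ereal a" "f (prox v) = ereal b"
      using p(3) p0(3) by auto
    have E: "?E v0 = a + q (v0 - prox v0)" "?E v = b + q (v - prox v)"
      using p(4) p0(4) by (simp_all add: ab)
    have "f (prox v) + ereal (q (v - prox v)) \<le> f (prox v0) + ereal (q (v - prox v0))"
      using z R unfolding is_prox_def by (metis \<psi>)
    moreover have "f (prox v0) + ereal (q (v0 - prox v0)) \<le> f (prox v) + ereal (q (v0 - prox v))"
      using z0 R unfolding is_prox_def by (metis \<psi>)
    moreover have "q (v0 - prox v) + Q (v0 - prox v) \<bullet> (v - v0) \<le> q (v - prox v)"
      using gradient_inequality[OF R(2,4)] by simp
    moreover have "q (v - prox v0) - Q (v - prox v0) \<bullet> (v - v0) \<le> q (v0 - prox v0)"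
      using gradient_inequality[OF R(3,1)] by (simp add: inner_diff_right)
    ultimately show ?case unfolding E by (simp add: ab)
  qed
  then show "GDERIV ?E v0 :> Q (v0 - prox v0)"
    by (rule GDERIV_sandwich) (rule kernel_gradient_tendsto[OF g ev])+
qed

theorem envelope_continuously_differentiable:
  shows "\<forall>\<^sub>F v in nhds vb. has_egradient envelope (Q (v - prox v)) v"
    and "((\<lambda>v. Q (v - prox v)) \<longlongrightarrow> Q (vb - prox vb)) (nhds vb)"
    and "prox vb = zb"
proof -
  have "\<forall>\<^sub>F v in nhds vb. \<forall>\<^sub>F v' in nhds v. well_placed v'"
    using eventually_well_placed by (simp add: eventually_eventually)
  then show "\<forall>\<^sub>F v in nhds vb. has_egradient envelope (Q (v - prox v)) v"
    using eventually_growth by eventually_elim (rule envelope_has_egradient)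
  show "((\<lambda>v. Q (v - prox v)) \<longlongrightarrow> Q (vb - prox vb)) (nhds vb)"
    unfolding prox_centre
    by (rule kernel_gradient_tendsto(2)[OF growth_at_centre eventually_well_placed])
qed (rule prox_centre)

end

section \<open>Smoothness of the envelope for small parameters and stationarity\<close>

text \<open>Splitting \<open>1/lam\<close> as \<open>1/lam1 + (1/lam - 1/lam1)\<close>: the first part is absorbed by the lower bound
  on the envelope with parameter \<open>lam1\<close>, the second is a surplus that blows up as \<open>lam\<close>
  tends to 0.\<close>

lemma penalty_lower_bound:
  fixes f \<phi> :: "'a::real_vector \<Rightarrow> ereal"
  assumes f: "proper_fun f" and \<beta>: "ereal \<beta> \<le> phi_envelope \<phi> lam1 f v"
    and lam: "0 < lam" "lam < lam1" and c: "ereal c \<le> \<phi> (v - z)"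
  shows "ereal (\<beta> + (1 / lam - 1 / lam1) * c) \<le> f z + ereal (1 / lam) * \<phi> (v - z)"
proof (cases "\<phi> (v - z)")
  case (real a)
  have "ereal \<beta> \<le> f z + ereal (1 / lam1) * \<phi> (v - z)"
    using \<beta> unfolding phi_envelope_def by (rule order_trans) (rule INF_lower, simp)
  moreover have "(1 / lam - 1 / lam1) * c \<le> (1 / lam - 1 / lam1) * a"
    using c lam by (intro mult_left_mono) (auto simp: real frac_le)
  ultimately show ?thesis
    by (cases "f z") (auto simp: real left_diff_distrib)
next
  case PInf
  have "f z \<noteq> - \<infinity>" using f unfolding proper_fun_def by (metis less_irrefl)
  then show ?thesis using PInf lam by simp
qed (use c in auto)

lemma eventually_small_multiple:
  fixes X Y :: real
  assumes "0 < Y"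
  shows "\<forall>\<^sub>F l in at_right 0. l * X < Y"
proof -
  have "((\<lambda>l. l * X) \<longlongrightarrow> 0 * X) (at_right 0)" by (intro tendsto_intros)
  then show ?thesis by (rule order_tendstoD) (use assms in simp)
qed

text \<open>Four smallness conditions on \<open>lam\<close> reduce the claim to the local analysis above:
  \<open>lam < lam1\<close>, so that the surplus of \<open>penalty_lower_bound\<close> is positive;
  \<open>lam \<parallel>yb\<parallel> < \<mu> \<delta>/2\<close>, which forces \<open>\<parallel>w\<parallel> < \<delta>\<close>; \<open>lam r < \<mu>\<close>, so that the curvature of \<open>\<phi>/lam\<close>
  dominates; and \<open>lam T < c\<close>, which excludes points at distance at least \<open>\<delta>\<close> from \<open>v\<close>
  as competitors. None of them involves \<open>w\<close>, which is why one threshold serves all \<open>w\<close>.\<close>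

theorem phi_envelope_continuously_differentiable:
  fixes \<phi> f :: "real^'m \<Rightarrow> ereal"
  assumes \<phi>: "proper_fun \<phi>" "convex_fun \<phi>" "open (edom \<phi>)" "twice_cont_diff_on (edom \<phi>) \<phi>"
      "\<forall>w\<in>edom \<phi>. pos_def_matrix (ehessian \<phi> w)" "\<phi> 0 = 0" "egrad \<phi> 0 = 0"
    and f: "proper_fun f" "lsc_fun f" "prox_bounded \<phi> f" "prox_regular f zb yb"
  shows "\<exists>lam0>0. \<forall>lam w. 0 < lam \<and> lam < lam0 \<and> w \<in> edom \<phi> \<and> yb = (1 / lam) *\<^sub>R egrad \<phi> w \<longrightarrow>
    (\<exists>D. (\<forall>\<^sub>F v in nhds (zb + w). has_egradient (phi_envelope \<phi> lam f) (D v) v) \<and>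
         (D \<longlongrightarrow> D (zb + w)) (nhds (zb + w)) \<and> D (zb + w) = yb)"
proof -
  let ?p = "\<lambda>x. real_of_ereal (\<phi> x)" and ?P = "egrad \<phi>"
  have \<phi>_MInf: "\<phi> x \<noteq> - \<infinity>" for x using \<phi>(1) unfolding proper_fun_def by (metis less_irrefl)
  have p: "\<phi> x = ereal (?p x)" if "x \<in> edom \<phi>" for x
    using that \<phi>_MInf[of x] by (cases "\<phi> x") (auto simp: edom_def)
  have grad: "has_egradient \<phi> (?P x) x" if "x \<in> edom \<phi>" for x
    using \<phi>(4) that egrad_eq unfolding twice_cont_diff_on_def edifferentiable_def by blast
  have "0 \<in> edom \<phi>" by (simp add: edom_def \<phi>)
  then obtain R \<mu> where R: "R > 0" "cball 0 R \<subseteq> edom \<phi>" and \<mu>: "\<mu> > 0"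
    and strong: "\<And>x y. norm x \<le> R \<Longrightarrow> norm y \<le> R \<Longrightarrow>
      ?p x + ?P x \<bullet> (y - x) + \<mu> / 2 * (norm (y - x))\<^sup>2 \<le> ?p y"
    using strongly_convex_near_origin[OF \<phi>(3) _ \<phi>(4,5)] by metis
  have near0: "ereal (\<mu> / 2 * (norm y)\<^sup>2) \<le> \<phi> y" if "norm y \<le> R" for y
  proof -
    have "y \<in> edom \<phi>" using R(2) that by auto
    moreover have "\<mu> / 2 * (norm y)\<^sup>2 \<le> ?p y" using strong[of 0 y] that R(1) by (simp add: \<phi>)
    ultimately show ?thesis using p[of y] by (metis ereal_less_eq(3))
  qed
  have P_cont: "continuous_on (cball 0 R) ?P"
  proof (rule continuous_at_imp_continuous_on, rule ballI)
    fix x :: "real^'m" assume "x \<in> cball 0 R"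
    then show "isCont ?P x"
      using \<phi>(4) R(2) differentiable_imp_continuous_within unfolding twice_cont_diff_on_def by blast
  qed
  then have "bounded (?P ` cball 0 R)" by (intro compact_imp_bounded compact_continuous_image compact_cball)
  then obtain L where "\<forall>y\<in>?P ` cball 0 R. norm y \<le> L" unfolding bounded_iff by blast
  then have L: "norm (?P x) \<le> L" if "norm x \<le> R" for x using that by simp

  obtain lam1 where lam1: "prox_bounded_param \<phi> f lam1" using f(3) unfolding prox_bounded_def by blast
  then have "lam1 > 0" by (simp add: prox_bounded_param_def)
  obtain \<epsilon>1 \<beta>' where \<epsilon>1: "\<epsilon>1 > 0" and \<beta>': "\<beta>' > - \<infinity>"
    "\<And>v. norm (v - zb) \<le> \<epsilon>1 \<Longrightarrow> \<beta>' \<le> phi_envelope \<phi> lam1 f v"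
    using lam1 unfolding prox_bounded_param_def by blast
  obtain \<beta> where \<beta>: "\<And>v. norm (v - zb) \<le> \<epsilon>1 \<Longrightarrow> ereal \<beta> \<le> phi_envelope \<phi> lam1 f v"
  proof -
    obtain \<beta> where "ereal \<beta> < \<beta>'" using \<beta>'(1) by (metis lt_ex ereal_dense2)
    then show ?thesis using that \<beta>'(2) by (meson less_imp_le order_trans)
  qed
  have zb: "\<bar>f zb\<bar> \<noteq> \<infinity>" "yb \<in> limiting_subdiff f zb" using f(4) by (auto simp: prox_regular_def)
  then obtain a where a: "f zb = ereal a" by auto
  obtain \<epsilon> r where \<epsilon>: "\<epsilon> > 0" "r \<ge> 0" and regular:
    "\<And>z' z y. \<lbrakk>norm (z' - zb) < \<epsilon>; norm (z - zb) < \<epsilon>; f z - f zb < ereal \<epsilon>;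
        y \<in> limiting_subdiff f z; norm (y - yb) < \<epsilon>\<rbrakk> \<Longrightarrow>
      f z + ereal (y \<bullet> (z' - z) - r / 2 * (norm (z' - z))\<^sup>2) \<le> f z'"
    using f(4) unfolding prox_regular_def by blast

  define \<delta> where "\<delta> = min (R / 3) (min (\<epsilon> / 2) \<epsilon>1)"
  have \<delta>: "0 < \<delta>" "3 * \<delta> \<le> R" "2 * \<delta> \<le> \<epsilon>" "\<delta> \<le> \<epsilon>1" using R(1) \<epsilon>(1) \<epsilon>1 by (auto simp: \<delta>_def)
  \<comment> \<open>\<open>c\<close> bounds the kernel below at distance at least \<open>\<delta>\<close> from the origin. \<open>T\<close> is chosen so that \<open>T < c / lam\<close> makes the penalised lower bound \<open>\<beta> + (1/lam - 1/lam1) c\<close> exceed \<open>a + \<parallel>yb\<parallel> \<delta> + 1\<close>, a bound on the value at \<open>zb\<close>; the summand 1 leaves room to move \<open>v\<close> away from \<open>zb + w\<close>.\<close>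
  define c where "c = \<mu> / 2 * \<delta>\<^sup>2"
  define T where "T = a + norm yb * \<delta> + 1 - \<beta> + c / lam1"
  have c: "c > 0" using \<mu> \<delta>(1) by (simp add: c_def)
  have linear: "ereal (\<mu> * \<delta> / 2 * norm x) \<le> \<phi> x" if "\<delta> \<le> norm x" for x
    by (rule convex_fun_linear_growth[where R = R]) (use \<phi> \<phi>_MInf near0 \<delta> that in auto)
  have "\<forall>\<^sub>F lam in at_right 0. lam * 1 < lam1 \<and> lam * norm yb < \<mu> * \<delta> / 2 \<and> lam * r < \<mu> \<and> lam * T < c"
    using \<open>lam1 > 0\<close> \<mu> \<delta>(1) c by (intro eventually_conj eventually_small_multiple) auto
  then obtain lam0 where lam0: "lam0 > 0" "\<And>lam. 0 < lam \<Longrightarrow> lam < lam0 \<Longrightarrow>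
      lam < lam1 \<and> lam * norm yb < \<mu> * \<delta> / 2 \<and> lam * r < \<mu> \<and> lam * T < c"
    unfolding eventually_at_right_field by auto
  show ?thesis
  proof (intro exI[of _ lam0] conjI allI impI lam0(1))
    fix lam w assume "0 < lam \<and> lam < lam0 \<and> w \<in> edom \<phi> \<and> yb = (1 / lam) *\<^sub>R ?P w"
    then have lam: "0 < lam" "lam < lam0" and w: "w \<in> edom \<phi>" and yb: "yb = (1 / lam) *\<^sub>R ?P w" by auto
    note small = lam0(2)[OF lam]
    have pw: "?p w \<le> lam * (yb \<bullet> w)"
      using convex_fun_gradient_bound[OF \<phi>(2,6) \<phi>_MInf grad[OF w]] lam yb by simp
    have w_le: "lam * (yb \<bullet> w) \<le> lam * (norm yb * norm w)"
      using lam norm_cauchy_schwarz[of yb w] by simp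
    have w_small: "norm w < \<delta>"
    proof (rule ccontr)
      assume "\<not> norm w < \<delta>"
      then have "\<delta> \<le> norm w" "norm w > 0" using \<delta>(1) by auto
      have "\<mu> * \<delta> / 2 * norm w \<le> ?p w"
        using linear[OF \<open>\<delta> \<le> norm w\<close>] p[OF w] by (metis ereal_less_eq(3))
      moreover have "lam * norm yb * norm w < \<mu> * \<delta> / 2 * norm w"
        using small \<open>norm w > 0\<close> by (intro mult_strict_right_mono) auto
      ultimately show False using pw w_le by (simp add: mult_ac)
    qed
    define q where "q = (\<lambda>x. ?p x / lam)"
    define Q where "Q = (\<lambda>x. (1 / lam) *\<^sub>R ?P x)"
    have q: "ereal (1 / lam) * \<phi> x = ereal (q x)" if "norm x < R" for x
    proof -
      have "x \<in> edom \<phi>" using R(2) that by auto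
      from p[OF this] show ?thesis unfolding q_def by (metis times_ereal.simps(1) mult.commute times_divide_eq_right mult_1_right)
    qed
    have Q_bound: "norm (Q x) \<le> L / lam" if "norm x < R" for x
      using L[of x] that lam by (simp add: Q_def divide_right_mono)
    have q_strong: "q x + Q x \<bullet> (y - x) + \<mu> / lam / 2 * (norm (y - x))\<^sup>2 \<le> q y"
      if "norm x < R" "norm y < R" for x y
    proof -
      have "(?p x + ?P x \<bullet> (y - x) + \<mu> / 2 * (norm (y - x))\<^sup>2) / lam \<le> ?p y / lam"
        using that lam by (intro divide_right_mono strong) auto
      then show ?thesis by (simp add: q_def Q_def add_divide_distrib)
    qed
    have Q_cont: "continuous_on (ball 0 R) Q"
      unfolding Q_def by (intro continuous_intros continuous_on_subset[OF P_cont]) auto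
    have far: "\<forall>\<^sub>F v in nhds (zb + w). \<forall>z. \<delta> \<le> norm (v - z) \<longrightarrow>
        f zb + ereal (1 / lam) * \<phi> (v - zb) < f z + ereal (1 / lam) * \<phi> (v - z)"
    proof -
      have wR: "w \<in> ball 0 R" using w_small \<delta> by simp
      have "isCont ?p w"
        using grad[OF w] has_derivative_continuous unfolding has_egradient_def gderiv_def by blast
      then have "((\<lambda>v. ?p (v - zb) / lam) \<longlongrightarrow> ?p w / lam) (nhds (zb + w))"
        using lam by (intro tendsto_divide tendsto_const isCont_tendsto_compose[of _ ?p])
          (auto intro!: tendsto_eq_intros filterlim_ident)
      moreover have "?p w / lam < yb \<bullet> w + 1"
        using pw lam by (simp add: field_simps)
      ultimately have "\<forall>\<^sub>F v in nhds (zb + w). ?p (v - zb) / lam < yb \<bullet> w + 1"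
        by (rule order_tendstoD)
      moreover have "((\<lambda>v. norm (v - zb)) \<longlongrightarrow> norm w) (nhds (zb + w))"
        by (auto intro!: tendsto_eq_intros filterlim_ident)
      then have "\<forall>\<^sub>F v in nhds (zb + w). norm (v - zb) < \<delta>"
        using w_small by (rule order_tendstoD)
      ultimately show ?thesis
      proof eventually_elim
        case (elim v)
        show ?case
        proof (intro allI impI)
          fix z assume z: "\<delta> \<le> norm (v - z)"
          have "ereal c \<le> ereal (\<mu> * \<delta> / 2 * norm (v - z))"
            using z \<mu> \<delta>(1) by (simp add: c_def power2_eq_square)
          also have "\<dots> \<le> \<phi> (v - z)" by (rule linear[OF z])
          finally have cz: "ereal c \<le> \<phi> (v - z)" .
          have "yb \<bullet> w \<le> norm yb * norm w" by (rule norm_cauchy_schwarz)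
          also have "\<dots> \<le> norm yb * \<delta>" using w_small by (intro mult_left_mono) auto
          finally have "?p (v - zb) / lam < norm yb * \<delta> + 1" using elim(1) by linarith
          moreover have "T < c / lam" using small lam by (simp add: field_simps)
          ultimately have "a + q (v - zb) < \<beta> + (1 / lam - 1 / lam1) * c"
            by (simp add: T_def q_def left_diff_distrib)
          moreover have "f zb + ereal (1 / lam) * \<phi> (v - zb) = ereal (a + q (v - zb))"
            using q[of "v - zb"] elim(2) \<delta> by (simp add: a)
          ultimately have "f zb + ereal (1 / lam) * \<phi> (v - zb) < ereal (\<beta> + (1 / lam - 1 / lam1) * c)" by simp
          also have "\<dots> \<le> f z + ereal (1 / lam) * \<phi> (v - z)"
            using elim(2) \<delta>(4) small cz lam by (intro penalty_lower_bound[OF f(1)] \<beta>) auto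
          finally show "f zb + ereal (1 / lam) * \<phi> (v - zb) < f z + ereal (1 / lam) * \<phi> (v - z)" .
        qed
      qed
    qed
    have "r < \<mu> / lam" using small lam by (simp add: field_simps)
    have Qw: "Q (zb + w - zb) = yb" by (simp add: Q_def yb)
    interpret E: local_prox_regular_convolution f "\<lambda>x. ereal (1 / lam) * \<phi> x" q Q R "\<mu> / lam" "L / lam" r \<delta> \<epsilon> zb "zb + w"
      by (unfold_locales; (unfold Qw)?)
        (fact f q q_strong Q_cont Q_bound \<delta> zb \<epsilon> \<open>r < \<mu> / lam\<close> far regular | simp add: w_small)+
    have env: "E.envelope = phi_envelope \<phi> lam f"
      by (simp add: fun_eq_iff E.envelope_def phi_envelope_def)
    show "\<exists>D. (\<forall>\<^sub>F v in nhds (zb + w). has_egradient (phi_envelope \<phi> lam f) (D v) v) \<and>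
         (D \<longlongrightarrow> D (zb + w)) (nhds (zb + w)) \<and> D (zb + w) = yb"
      using E.envelope_continuously_differentiable Qw unfolding env
      by (intro exI[of _ "\<lambda>v. Q (v - E.prox v)"]) simp
  qed
qed

theorem corollary4p4:
  fixes \<phi> f :: "real^'m \<Rightarrow> ereal" and g :: "real^'n \<Rightarrow> ereal" and A :: "real^'n^'m"
    and zb yb :: "real^'m"
  assumes A1: "legendre \<phi>"
    and A2: "open (edom \<phi>)"
    and A3: "twice_cont_diff_on (interior (edom \<phi>)) \<phi>"
      "\<forall>w\<in>interior (edom \<phi>). pos_def_matrix (ehessian \<phi> w)"
    and A4: "super_coercive \<phi>"
    and A5: "\<phi> 0 = 0" "egrad \<phi> 0 = 0"
    and f: "proper_fun f" "lsc_fun f"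
    and g: "proper_fun g" "lsc_fun g"
    and f_bounded: "prox_bounded \<phi> f"
    and f_regular: "prox_regular f zb yb"
  shows "\<exists>lam0>0. \<forall>lam ub.
    0 < lam \<and> lam < lam0 \<and> ereal lam < prox_threshold \<phi> f \<and>
    stationary (splitting_objective \<phi> lam f g A) (ub, zb) \<and>
    A *v ub - zb \<in> edom \<phi> \<and> ub \<in> edom g \<and> zb \<in> edom f \<and>
    0 \<in> (\<lambda>y. y + (1 / lam) *\<^sub>R (transpose A *v egrad \<phi> (A *v ub - zb))) ` limiting_subdiff g ub \<and>
    0 \<in> (\<lambda>y. y - (1 / lam) *\<^sub>R egrad \<phi> (A *v ub - zb)) ` limiting_subdiff f zb \<and>
    yb = (1 / lam) *\<^sub>R egrad \<phi> (A *v ub - zb)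
    \<longrightarrow>
    edifferentiable (phi_envelope \<phi> lam f) (A *v ub) \<and>
    0 \<in> (\<lambda>y. transpose A *v egrad (phi_envelope \<phi> lam f) (A *v ub) + y) ` limiting_subdiff g ub \<and>
    stationary (inf_conv_objective \<phi> lam f g A) ub"
proof -
  have int: "interior (edom \<phi>) = edom \<phi>" using A2 by (rule interior_open)
  have "proper_fun \<phi>" "convex_fun \<phi>" using A1 by (auto simp: legendre_def)
  from phi_envelope_continuously_differentiable[OF this A2 A3[unfolded int] A5 f f_bounded f_regular]
  obtain lam0 where lam0: "lam0 > 0" and
    C1: "\<And>lam w. 0 < lam \<Longrightarrow> lam < lam0 \<Longrightarrow> w \<in> edom \<phi> \<Longrightarrow> yb = (1 / lam) *\<^sub>R egrad \<phi> w \<Longrightarrow>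
      \<exists>D. (\<forall>\<^sub>F v in nhds (zb + w). has_egradient (phi_envelope \<phi> lam f) (D v) v) \<and>
         (D \<longlongrightarrow> D (zb + w)) (nhds (zb + w)) \<and> D (zb + w) = yb"
    by blast
  show ?thesis
  proof (intro exI[of _ lam0] conjI[OF lam0] allI impI)
    fix lam ub
    let ?e = "phi_envelope \<phi> lam f" and ?w = "A *v ub - zb"
    assume "0 < lam \<and> lam < lam0 \<and> ereal lam < prox_threshold \<phi> f \<and>
      stationary (splitting_objective \<phi> lam f g A) (ub, zb) \<and>
      A *v ub - zb \<in> edom \<phi> \<and> ub \<in> edom g \<and> zb \<in> edom f \<and>
      0 \<in> (\<lambda>y. y + (1 / lam) *\<^sub>R (transpose A *v egrad \<phi> (A *v ub - zb))) ` limiting_subdiff g ub \<and>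
      0 \<in> (\<lambda>y. y - (1 / lam) *\<^sub>R egrad \<phi> (A *v ub - zb)) ` limiting_subdiff f zb \<and>
      yb = (1 / lam) *\<^sub>R egrad \<phi> (A *v ub - zb)"
    then have lam: "0 < lam" "lam < lam0" and w: "?w \<in> edom \<phi>"
      and yb: "yb = (1 / lam) *\<^sub>R egrad \<phi> ?w"
      and "0 \<in> (\<lambda>y. y + (1 / lam) *\<^sub>R (transpose A *v egrad \<phi> ?w)) ` limiting_subdiff g ub"
      by blast+
    then obtain y where y: "y \<in> limiting_subdiff g ub" "transpose A *v yb + y = 0"
      by (auto simp: matrix_vector_mult_scaleR add.commute simp del: transpose_matrix_vector)
    from C1[OF lam w yb] obtain D
      where D: "\<forall>\<^sub>F v in nhds (A *v ub). has_egradient ?e (D v) v"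
        "(D \<longlongrightarrow> D (A *v ub)) (nhds (A *v ub))" "D (A *v ub) = yb"
      by auto
    have e: "has_egradient ?e yb (A *v ub)" using eventually_nhds_x_imp_x[OF D(1)] D(3) by simp
    have "isCont ((*v) A) ub" by (rule matrix_vector_mult_linear_continuous_at)
    then have lim: "((*v) A \<longlongrightarrow> A *v ub) (nhds ub)"
      unfolding continuous_at by (rule tendsto_at_iff_tendsto_nhds[THEN iffD1])
    have "\<forall>\<^sub>F u in nhds ub. has_egradient ?e (D (A *v u)) (A *v u)"
      using D(1) lim unfolding filterlim_iff by blast
    then have "\<forall>\<^sub>F u in nhds ub. has_egradient (\<lambda>u. ?e (A *v u)) (transpose A *v D (A *v u)) u"
      by (rule eventually_mono) (rule has_egradient_compose_matrix)
    moreover have "((\<lambda>u. transpose A *v D (A *v u)) \<longlongrightarrow> transpose A *v D (A *v ub)) (nhds ub)"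
      by (intro bounded_linear.tendsto[OF matrix_vector_mul_bounded_linear] filterlim_compose[OF D(2) lim])
    ultimately have "transpose A *v D (A *v ub) + y \<in> limiting_subdiff (\<lambda>u. ?e (A *v u) + g u) ub"
      by (rule limiting_subdiff_add_smooth[OF y(1)])
    then have "stationary (inf_conv_objective \<phi> lam f g A) ub"
      unfolding stationary_def inf_conv_objective_def D(3) y(2) .
    moreover have "0 \<in> (\<lambda>y. transpose A *v egrad ?e (A *v ub) + y) ` limiting_subdiff g ub"
      using y unfolding egrad_eq[OF e] by (metis imageI)
    ultimately show "edifferentiable ?e (A *v ub) \<and>
        0 \<in> (\<lambda>y. transpose A *v egrad ?e (A *v ub) + y) ` limiting_subdiff g ub \<and>
        stationary (inf_conv_objective \<phi> lam f g A) ub"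
      using e unfolding edifferentiable_def by blast
  qed
qed

end
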